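(* Let $d \geq 1$ be an integer, let $g \in S_0(\mathbb{R}^d)$ (Feichtinger's algebra) be an odd function, i.e. $g(t) = -g(-t)$ for all $t \in \mathbb{R}^d$, and let $\Lambda \subset \mathbb{R}^{2d}$ be a symplectic lattice with $\mathrm{vol}(\Lambda) = 2^{-d}$. Then the Gabor system $\mathcal{G}(g,\Lambda)$ is not a Gabor frame for $L^2(\mathbb{R}^d)$; that is, $\Lambda \notin \mathfrak{F}_{full}(g)$.
   Context: Inner product on $L^2(\mathbb{R}^d)$: $\langle f,g\rangle = \int_{\mathbb{R}^d} f(t)\overline{g(t)}\,dt$, with norm $\|f\|$. Time-frequency shifts: for $\lambda = (x,\omega) \in \mathbb{R}^d\times\mathbb{R}^d = \mathbb{R}^{2d}$, $\pi(\lambda) g(t) = e^{2\pi i \omega\cdot t} g(t-x)$. Short-time Fourier transform: $\mathcal{V}_g f(\lambda) = \langle f, \pi(\lambda) g\rangle = \int_{\mathbb{R}^d} f(t)\overline{g(t-x)}e^{-2\pi i\omega\cdot t}\,dt$. Feichtinger's algebra $S_0(\mathbb{R}^d)$: the set of all $g \in L^2(\mathbb{R}^d)$ such that $\mathcal{V}_g g \in L^1(\mathbb{R}^{2d})$. Elements are identified with their continuous representatives. Lattice: $\Lambda = M\mathbb{Z}^{2d}$ with $M \in GL(2d,\mathbb{R})$; its volume is $\mathrm{vol}(\Lambda) = |\det M|$. Let $J = \begin{pmatrix} 0 & I\\ -I & 0\end{pmatrix}$ with $I$ the $d\times d$ identity matrix; a real $2d\times 2d$ matrix $S$ is symplectic,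 $S \in Sp(d)$, if $S^T J S = J$. The lattice $\Lambda$ is called symplectic if $\Lambda = c\,S\mathbb{Z}^{2d}$ for some $c>0$ and $S \in Sp(d)$. Gabor system: $\mathcal{G}(g,\Lambda) = \{\pi(\lambda) g \mid \lambda\in\Lambda\}$. It is a (Gabor) frame if there exist constants $0<A\le B<\infty$ such that $A\|f\|^2 \le \sum_{\lambda\in\Lambda} |\langle f,\pi(\lambda) g\rangle|^2 \le B\|f\|^2$ for all $f\in L^2(\mathbb{R}^d)$. Full frame set: $\mathfrak{F}_{full}(g) = \{\Lambda\subset\mathbb{R}^{2d} \text{ a lattice} \mid \mathcal{G}(g,\Lambda) \text{ is a frame}\}$. *)

theory Defs
  imports "HOL-Analysis.Analysis"
begin

text \<open>
  \<open>\<real>\<^sup>d\<close> is \<^typ>\<open>real^'n\<close> with \<open>d = CARD('n)\<close>, so \<open>d \<ge> 1\<close> holds automatically, and the phase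
  space \<open>\<real>\<^sup>2\<^sup>d\<close> is \<^typ>\<open>real^('n + 'n)\<close>: the \<^const>\<open>Inl\<close> coordinates are the position \<open>x\<close>, the
  \<^const>\<open>Inr\<close> coordinates the frequency \<open>\<omega>\<close>.

  Elements of \<open>L\<^sup>2\<close> are represented by Borel functions, not by equivalence classes; every Lebesgue
  measurable function agrees almost everywhere with a Borel one, and everything below other than
  continuity and oddness depends on a function only up to null sets.
\<close>

subsection \<open>Square-integrable functions and frames\<close>

definition L2 :: "(real^'n \<Rightarrow> complex) set" where
  "L2 = {f. f \<in> borel_measurable lborel \<and> integrable lborel (\<lambda>t. (cmod (f t))\<^sup>2)}"

definition L2_inner :: "(real^'n \<Rightarrow> complex) \<Rightarrow> (real^'n \<Rightarrow> complex) \<Rightarrow> complex" where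
  "L2_inner f g = (LINT t|lborel. f t * cnj (g t))"

definition L2_norm :: "(real^'n \<Rightarrow> complex) \<Rightarrow> real" where
  "L2_norm f = sqrt (LINT t|lborel. (cmod (f t))\<^sup>2)"

text \<open>
  Summability is required explicitly because \<^const>\<open>infsum\<close> is \<open>0\<close> on families that are not summable,
  whereas the upper frame bound is meant to say that the sum is finite.
\<close>

definition is_frame :: "('i \<Rightarrow> real^'n \<Rightarrow> complex) \<Rightarrow> 'i set \<Rightarrow> bool" where
  "is_frame \<phi> I \<longleftrightarrow>
     (\<exists>A B. 0 < A \<and> A \<le> B \<and>
        (\<forall>f\<in>L2. (\<lambda>i. (cmod (L2_inner f (\<phi> i)))\<^sup>2) summable_on I \<and>
          A * (L2_norm f)\<^sup>2 \<le> (\<Sum>\<^sub>\<infinity>i\<in>I. (cmod (L2_inner f (\<phi> i)))\<^sup>2) \<and>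
          (\<Sum>\<^sub>\<infinity>i\<in>I. (cmod (L2_inner f (\<phi> i)))\<^sup>2) \<le> B * (L2_norm f)\<^sup>2))"

subsection \<open>Time-frequency analysis\<close>

definition pos :: "real^('n + 'n) \<Rightarrow> real^'n" where
  "pos l = (\<chi> i. l $ Inl i)"

definition freq :: "real^('n + 'n) \<Rightarrow> real^'n" where
  "freq l = (\<chi> i. l $ Inr i)"

definition tf_shift :: "real^('n + 'n) \<Rightarrow> (real^'n \<Rightarrow> complex) \<Rightarrow> real^'n \<Rightarrow> complex" where
  "tf_shift l g = (\<lambda>t. exp (2 * of_real pi * \<i> * of_real (freq l \<bullet> t)) * g (t - pos l))"

definition stft :: "(real^'n \<Rightarrow> complex) \<Rightarrow> (real^'n \<Rightarrow> complex) \<Rightarrow> real^('n + 'n) \<Rightarrow> complex" where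
  "stft g f l = L2_inner f (tf_shift l g)"

text \<open>
  Feichtinger's algebra. Continuity selects the continuous representative of each class.
\<close>

definition S0 :: "(real^'n \<Rightarrow> complex) set" where
  "S0 = {g \<in> L2. continuous_on UNIV g \<and> integrable lborel (stft g g)}"

subsection \<open>Lattices\<close>

definition lattice_of :: "real^'m^'m \<Rightarrow> (real^'m) set" where
  "lattice_of M = (*v) M ` {z. \<forall>i. z $ i \<in> \<int>}"

definition is_lattice :: "(real^'m) set \<Rightarrow> bool" where
  "is_lattice \<Lambda> \<longleftrightarrow> (\<exists>M. invertible M \<and> \<Lambda> = lattice_of M)"

definition lattice_vol :: "(real^'m) set \<Rightarrow> real" where
  "lattice_vol \<Lambda> = (THE v. \<exists>M. invertible M \<and> \<Lambda> = lattice_of M \<and> v = \<bar>det M\<bar>)"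

definition J_mat :: "real^('n::finite + 'n)^('n + 'n)" where
  "J_mat = (\<chi> r c. case (r, c) of
      (Inl i, Inr j) \<Rightarrow> if i = j then 1 else 0
    | (Inr i, Inl j) \<Rightarrow> if i = j then -1 else 0
    | _ \<Rightarrow> 0)"

definition symplectic :: "real^('n::finite + 'n)^('n + 'n) \<Rightarrow> bool" where
  "symplectic S \<longleftrightarrow> transpose S ** J_mat ** S = J_mat"

definition symplectic_lattice :: "(real^('n::finite + 'n)) set \<Rightarrow> bool" where
  "symplectic_lattice \<Lambda> \<longleftrightarrow> (\<exists>c S. c > 0 \<and> symplectic S \<and> \<Lambda> = lattice_of (c *\<^sub>R S))"

text \<open>The volume does not depend on the generating matrix, so the description above is proper.\<close>

lemma det_Ints: "(\<And>i j. U $ i $ j \<in> \<int>) \<Longrightarrow> det (U :: real^'m^'m) \<in> \<int>"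
  unfolding det_def by (intro Ints_sum Ints_mult Ints_prod) auto

lemma lattice_of_subset_det:
  fixes M N :: "real^'m^'m"
  assumes "lattice_of M \<subseteq> lattice_of N"
  shows "\<exists>k\<in>\<int>. det M = det N * k"
proof -
  have "\<exists>z. (\<forall>i. z $ i \<in> \<int>) \<and> column j M = N *v z" for j
  proof -
    have "column j M = M *v axis j 1"
      by (simp add: matrix_vector_mult_basis)
    moreover have "\<forall>i. (axis j 1 :: real^'m) $ i \<in> \<int>"
      by (simp add: axis_def)
    ultimately have "column j M \<in> lattice_of M"
      unfolding lattice_of_def by blast
    with assms show ?thesis
      unfolding lattice_of_def by blast
  qed
  then obtain z where z: "\<And>j i. z j $ i \<in> \<int>" "\<And>j. column j M = N *v z j"
    by metis
  define U :: "real^'m^'m" where "U = (\<chi> i j. z j $ i)"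
  have "M = N ** U"
    using z(2) by (simp add: vec_eq_iff column_def U_def matrix_matrix_mult_def matrix_vector_mult_def)
  moreover have "det U \<in> \<int>"
    by (rule det_Ints) (simp add: U_def z)
  ultimately show ?thesis
    by (auto simp: det_mul)
qed

lemma lattice_vol_lattice_of:
  fixes M :: "real^'m^'m"
  assumes "invertible M"
  shows "lattice_vol (lattice_of M) = \<bar>det M\<bar>"
proof -
  have le: "\<bar>det P\<bar> \<le> \<bar>det Q\<bar>"
    if inv: "invertible Q" and eq: "lattice_of Q = lattice_of P" for P Q :: "real^'m^'m"
  proof -
    obtain k where k: "k \<in> \<int>" "det Q = det P * k"
      using lattice_of_subset_det[of Q P] eq by blast
    have "det Q \<noteq> 0"
      using inv by (simp add: invertible_det_nz)
    with k have "\<bar>k\<bar> \<ge> 1"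
      by (intro Ints_nonzero_abs_ge1) auto
    then show ?thesis
      using mult_left_mono[of 1 "\<bar>k\<bar>" "\<bar>det P\<bar>"] by (simp add: k abs_mult)
  qed
  show ?thesis
    unfolding lattice_vol_def
  proof (rule the_equality)
    show "\<exists>N. invertible N \<and> lattice_of M = lattice_of N \<and> \<bar>det M\<bar> = \<bar>det N\<bar>"
      using assms by blast
  next
    fix v assume "\<exists>N. invertible N \<and> lattice_of M = lattice_of N \<and> v = \<bar>det N\<bar>"
    then show "v = \<bar>det M\<bar>"
      using le assms by (metis order_antisym)
  qed
qed

subsection \<open>Gabor frames\<close>

definition gabor_frame :: "(real^'n \<Rightarrow> complex) \<Rightarrow> (real^('n + 'n)) set \<Rightarrow> bool" where
  "gabor_frame g \<Lambda> \<longleftrightarrow> is_frame (\<lambda>l. tf_shift l g) \<Lambda>"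

definition full_frame_set :: "(real^'n \<Rightarrow> complex) \<Rightarrow> (real^('n + 'n)) set set" where
  "full_frame_set g = {\<Lambda>. is_lattice \<Lambda> \<and> gabor_frame g \<Lambda>}"

end

theory Submission
  imports Defs "HOL-Probability.Characteristic_Functions"
begin

text \<open>
  Let \<open>\<rho>(z)\<close> be the symmetrically normalised time-frequency shift and \<open>h\<close> the standard Gaussian.
  With \<open>\<sigma>\<close> the symplectic form, \<open>\<rho>(a) \<rho>(b) = e\<^bsup>\<pi>i \<sigma>(a, b)\<^esup> \<rho>(a + b)\<close>.
  As \<open>\<Lambda> = c S \<int>\<^sup>2\<^sup>d\<close> with \<open>c\<^sup>2 = 1/2\<close>, \<open>\<sigma>\<close> is half-integral on \<open>\<Lambda>\<close>, so \<open>\<rho>\<close> is a homomorphism on \<open>2\<Lambda>\<close>. Put \<open>T(u) = \<Sum>\<^bsub>\<nu> \<in> 2\<Lambda>\<^esub> \<langle>\<rho>(\<nu>) h, u\<rangle>\<close>, a functional invariant under \<open>\<rho>(2\<Lambda>)\<close>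
  and under reflection of \<open>u\<close>. For \<open>\<lambda> \<in> \<Lambda>\<close>, reflection sends \<open>\<rho>(\<lambda>) g\<close> to
  \<open>-\<rho>(-\<lambda>) g\<close>, and \<open>\<rho>(2\<lambda>)\<close> brings this back to \<open>-\<rho>(\<lambda>) g\<close>; hence \<open>T(\<rho>(\<lambda>) g) = 0\<close>.

  Truncating \<open>T\<close> to a large box \<open>F\<close> of \<open>2\<Lambda>\<close> gives \<open>f = \<Sum>\<^bsub>\<nu> \<in> F\<^esub> \<rho>(\<nu>) h\<close>. Its frame coefficients are small
  away from the boundary of the box, so their square sum is \<open>o(|F|)\<close>, whereas \<open>\<parallel>f\<parallel>\<^sup>2\<close> is at least
  \<open>|F| \<parallel>h\<parallel>\<^sup>2\<close> since the Gaussian inner products \<open>\<langle>\<rho>(\<nu>) h, \<rho>(\<nu>') h\<rangle>\<close> are positive on \<open>2\<Lambda>\<close>.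
  The lower frame bound fails.

  Absolute convergence of \<open>T(\<rho>(\<lambda>) g)\<close> is where \<open>g \<in> S\<^sub>0\<close> enters: by Moyal's formula
  \<open>|\<langle>g, \<rho>(a) h\<rangle>| |\<langle>g, \<rho>(b) h\<rangle>|\<close> is at most the integral of \<open>|V\<^sub>g g|\<close> against a Gaussian centred at \<open>a - b\<close>.
\<close>

subsection \<open>Gaussian integrals\<close>

text \<open>Fubini over coordinates: \<open>lborel\<close> is the image of the product measure
  indexed by \<open>Basis\<close>. This reduces Gaussian integrals to dimension one.\<close>

lemma has_bochner_integral_lborel_prod:
  fixes f :: "'a::euclidean_space \<Rightarrow> real \<Rightarrow> 'b::{real_normed_field,banach,second_countable_topology}"
  assumes "\<And>b. b \<in> Basis \<Longrightarrow> integrable lborel (f b)"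
  shows "has_bochner_integral lborel (\<lambda>x. \<Prod>b\<in>Basis. f b (x \<bullet> b)) (\<Prod>b\<in>Basis. integral\<^sup>L lborel (f b))"
proof -
  interpret product_sigma_finite "\<lambda>_::'a. lborel :: real measure"
    by standard
  have [measurable]: "f b \<in> borel_measurable borel" if "b \<in> Basis" for b
    using assms[OF that] by auto
  have *: "(\<lambda>y. \<Prod>b\<in>Basis. f b ((\<Sum>c\<in>Basis. y c *\<^sub>R c) \<bullet> b)) = (\<lambda>y. \<Prod>b\<in>Basis. f b (y b))"
    by (intro ext prod.cong refl) simp
  have int: "integrable (\<Pi>\<^sub>M b\<in>Basis. lborel) (\<lambda>y. \<Prod>b\<in>Basis. f b (y b))"
    using assms by (intro product_integrable_prod) auto
  show ?thesis
    unfolding has_bochner_integral_iff lborel_def[where 'a='a]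
    using int assms
    by (simp add: integrable_distr_eq integral_distr * product_integral_prod lborel_eq_real[symmetric])
qed

text \<open>A rescaling of the characteristic function of the standard normal distribution.\<close>

lemma has_bochner_integral_gaussian_real:
  fixes a \<xi> :: real
  assumes "a > 0"
  shows "has_bochner_integral lborel (\<lambda>x. exp (of_real (- pi * a * x\<^sup>2) + 2 * pi * \<i> * of_real (\<xi> * x)))
    (complex_of_real (exp (- pi * \<xi>\<^sup>2 / a) / sqrt a))"
proof -
  \<comment> \<open>With y = c x the normal exponent -y^2/2 becomes -pi a x^2, and \<open>t\<close>
    is chosen so that t y = 2 pi \<xi> x.\<close>
  define c where "c = sqrt (2 * pi * a)"
  have c: "c > 0" "c\<^sup>2 = 2 * pi * a"
    using assms by (auto simp: c_def)
  define t where "t = 2 * pi * \<xi> / c"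
  interpret real_distribution std_normal_distribution
    by (rule real_dist_normal_dist)
  have "integrable std_normal_distribution (\<lambda>y. iexp (t * y))"
    by (rule integrable_iexp) auto
  moreover have "(CLINT y|std_normal_distribution. iexp (t * y)) = of_real (exp (- (t^2) / 2))"
    using fun_cong[OF char_std_normal_distribution, of t] by (simp add: char_def)
  ultimately have "has_bochner_integral lborel (\<lambda>y. std_normal_density y *\<^sub>R iexp (t * y))
      (complex_of_real (exp (- (t^2) / 2)))"
    by (simp add: has_bochner_integral_iff integrable_density integral_density)
  then have "has_bochner_integral lborel (\<lambda>x. std_normal_density (0 + c * x) *\<^sub>R iexp (t * (0 + c * x)))
      (complex_of_real (exp (- (t^2) / 2)) /\<^sub>R \<bar>c\<bar>)"
    using c by (subst (asm) lborel_has_bochner_integral_real_affine_iff[of c _ _ 0]) auto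
  then have "has_bochner_integral lborel (\<lambda>x. sqrt (2 * pi) *\<^sub>R (std_normal_density (0 + c * x) *\<^sub>R iexp (t * (0 + c * x))))
      (sqrt (2 * pi) *\<^sub>R (complex_of_real (exp (- (t^2) / 2)) /\<^sub>R \<bar>c\<bar>))"
    by (rule has_bochner_integral_scaleR_right)
  moreover have "sqrt (2 * pi) *\<^sub>R (std_normal_density (0 + c * x) *\<^sub>R iexp (t * (0 + c * x)))
      = exp (of_real (- pi * a * x\<^sup>2) + 2 * pi * \<i> * of_real (\<xi> * x))" for x
  proof -
    have e: "(c * x)\<^sup>2 / 2 = pi * a * x\<^sup>2" "t * (0 + c * x) = 2 * pi * \<xi> * x"
      using c by (auto simp: power_mult_distrib t_def)
    have "sqrt (2 * pi) * std_normal_density (0 + c * x) = exp (- (pi * a * x\<^sup>2))"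
      unfolding std_normal_density_def using e(1) by simp
    then have "sqrt (2 * pi) *\<^sub>R (std_normal_density (0 + c * x) *\<^sub>R iexp (t * (0 + c * x)))
        = of_real (exp (- (pi * a * x\<^sup>2))) * iexp (2 * pi * \<xi> * x)"
      unfolding e(2) scaleR_scaleR by (simp only: scaleR_conv_of_real)
    then show ?thesis
      by (simp only: exp_add exp_of_real) (simp add: mult_ac)
  qed
  moreover have "sqrt (2 * pi) *\<^sub>R (complex_of_real (exp (- (t^2) / 2)) /\<^sub>R \<bar>c\<bar>)
      = complex_of_real (exp (- pi * \<xi>\<^sup>2 / a) / sqrt a)"
  proof -
    have "t^2 / 2 = pi * \<xi>\<^sup>2 / a"
      using c assms by (simp add: t_def power_divide power_mult_distrib field_simps power2_eq_square)
    moreover have "sqrt (2 * pi) / c = 1 / sqrt a"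
      by (simp add: c_def real_sqrt_mult)
    ultimately show ?thesis
      using c by (simp add: scaleR_conv_of_real field_simps flip: of_real_mult of_real_divide)
  qed
  ultimately show ?thesis by simp
qed

text \<open>For \<open>p = 0\<close> the integrand is a product of one-dimensional Gaussians;
  translating by \<open>p\<close> then contributes only the phase of
  \<open>\<xi> \<bullet> p\<close>.\<close>

lemma has_bochner_integral_gaussian:
  fixes \<xi> p :: "'a::euclidean_space"
  assumes "a > 0"
  shows "has_bochner_integral lborel
    (\<lambda>t. exp (of_real (- pi * a * (norm (t - p))\<^sup>2) + 2 * pi * \<i> * of_real (\<xi> \<bullet> t)))
    (exp (of_real (- pi * (norm \<xi>)\<^sup>2 / a) + 2 * pi * \<i> * of_real (\<xi> \<bullet> p)) / of_real (sqrt a ^ DIM('a)))"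
proof -
  define f where "f b x = exp (of_real (- pi * a * x\<^sup>2) + 2 * pi * \<i> * of_real (\<xi> \<bullet> b * x))" for b :: 'a and x
  have f: "integrable lborel (f b)"
    "integral\<^sup>L lborel (f b) = complex_of_real (exp (- pi * (\<xi> \<bullet> b)\<^sup>2 / a) / sqrt a)" for b
    using has_bochner_integral_gaussian_real[OF assms, of "\<xi> \<bullet> b"]
    by (auto simp: f_def[abs_def] has_bochner_integral_iff)
  have sq: "(norm x)\<^sup>2 = (\<Sum>b\<in>Basis. (x \<bullet> b)\<^sup>2)" for x :: 'a
    unfolding power2_norm_eq_inner euclidean_inner[of x x] by (simp add: power2_eq_square)
  have "(\<Prod>b\<in>Basis. f b (t \<bullet> b)) = exp (of_real (- pi * a * (norm t)\<^sup>2) + 2 * pi * \<i> * of_real (\<xi> \<bullet> t))" for t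
    unfolding f_def sq euclidean_inner[of \<xi> t]
    by (simp add: exp_sum[symmetric] sum.distrib sum_distrib_left sum_negf sum_subtractf)
  moreover have "(\<Prod>b\<in>Basis. integral\<^sup>L lborel (f b))
      = exp (of_real (- pi * (norm \<xi>)\<^sup>2 / a)) / of_real (sqrt a ^ DIM('a))"
    unfolding f(2) sq
    by (simp add: prod_dividef exp_of_real[symmetric] exp_sum[symmetric] sum_distrib_left sum_negf sum_divide_distrib flip: of_real_prod)
  ultimately have *: "has_bochner_integral lborel
      (\<lambda>t. exp (of_real (- pi * a * (norm t)\<^sup>2) + 2 * pi * \<i> * of_real (\<xi> \<bullet> t)))
      (exp (of_real (- pi * (norm \<xi>)\<^sup>2 / a)) / of_real (sqrt a ^ DIM('a)))"
    using has_bochner_integral_lborel_prod[of f, OF f(1)] by simp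
  have "has_bochner_integral (distr lborel borel ((+) (-p)))
      (\<lambda>t. exp (of_real (- pi * a * (norm t)\<^sup>2) + 2 * pi * \<i> * of_real (\<xi> \<bullet> t)))
      (exp (of_real (- pi * (norm \<xi>)\<^sup>2 / a)) / of_real (sqrt a ^ DIM('a)))"
    unfolding lborel_distr_plus by (rule *)
  then have "has_bochner_integral lborel
      (\<lambda>t. exp (of_real (- pi * a * (norm (- p + t))\<^sup>2) + 2 * pi * \<i> * of_real (\<xi> \<bullet> (- p + t))))
      (exp (of_real (- pi * (norm \<xi>)\<^sup>2 / a)) / of_real (sqrt a ^ DIM('a)))"
    by (simp add: has_bochner_integral_iff integrable_distr_eq integral_distr)
  from has_bochner_integral_mult_right[OF this, of "exp (2 * pi * \<i> * of_real (\<xi> \<bullet> p))"]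
  show ?thesis
    by (simp add: mult_exp_exp inner_diff_right algebra_simps)
qed

subsection \<open>Phase space and square-integrable functions\<close>

lemma pos_add: "pos (a + b) = pos a + pos b" and freq_add: "freq (a + b) = freq a + freq b"
  and pos_diff: "pos (a - b) = pos a - pos b" and freq_diff: "freq (a - b) = freq a - freq b"
  and pos_minus: "pos (- a) = - pos a" and freq_minus: "freq (- a) = - freq a"
  by (simp_all add: pos_def freq_def vec_eq_iff)

lemma measurable_pos [measurable]: "pos \<in> borel_measurable borel"
  and measurable_freq [measurable]: "freq \<in> borel_measurable borel"
  unfolding pos_def[abs_def] freq_def[abs_def]
  by (auto intro!: borel_measurable_continuous_onI continuous_intros)

lemma sum_UNIV_Plus: "(\<Sum>k\<in>UNIV. f k) = (\<Sum>i\<in>UNIV. f (Inl i)) + (\<Sum>j\<in>UNIV. f (Inr j))"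
  for f :: "'a::finite + 'b::finite \<Rightarrow> 'c::comm_monoid_add"
  by (simp add: UNIV_Plus_UNIV[symmetric] sum.Plus del: UNIV_Plus_UNIV)

lemma prod_UNIV_Plus: "(\<Prod>k\<in>UNIV. f k) = (\<Prod>i\<in>UNIV. f (Inl i)) * (\<Prod>j\<in>UNIV. f (Inr j))"
  for f :: "'a::finite + 'b::finite \<Rightarrow> 'c::comm_monoid_mult"
  by (simp add: UNIV_Plus_UNIV[symmetric] prod.Plus del: UNIV_Plus_UNIV)

lemma inner_phase_space: "a \<bullet> b = pos a \<bullet> pos b + freq a \<bullet> freq b"
  by (simp add: inner_vec_def pos_def freq_def sum_UNIV_Plus)

lemma norm_phase_space: "(norm a)\<^sup>2 = (norm (pos a))\<^sup>2 + (norm (freq a))\<^sup>2"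
  by (simp add: power2_norm_eq_inner inner_phase_space[of a])

definition phase_point :: "real^'n \<Rightarrow> real^'n \<Rightarrow> real^('n::finite + 'n)" where
  "phase_point x \<omega> = (\<chi> k. case k of Inl i \<Rightarrow> x $ i | Inr j \<Rightarrow> \<omega> $ j)"

lemma pos_phase_point [simp]: "pos (phase_point x \<omega>) = x"
  and freq_phase_point [simp]: "freq (phase_point x \<omega>) = \<omega>"
  by (simp_all add: phase_point_def pos_def freq_def)

lemma measurable_phase_point [measurable]:
  "case_prod phase_point \<in> (borel \<Otimes>\<^sub>M borel) \<rightarrow>\<^sub>M (borel :: (real^('n::finite + 'n)) measure)"
proof -
  have "continuous_on UNIV (\<lambda>p. phase_point (fst p) (snd p) $ k)" for k :: "'n + 'n"
    by (cases k) (auto simp: phase_point_def intro!: continuous_intros)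
  then have "continuous_on UNIV (\<lambda>p. \<chi> k :: 'n + 'n. phase_point (fst p) (snd p) $ k)"
    by (rule continuous_on_vec_lambda)
  then have "continuous_on UNIV (case_prod phase_point :: _ \<Rightarrow> real^('n + 'n))"
    by (simp add: case_prod_unfold)
  then show ?thesis
    by (simp add: borel_prod borel_measurable_continuous_onI)
qed

lemma prod_Basis_vec: "(\<Prod>b\<in>(Basis :: (real^'m) set). f b) = (\<Prod>i\<in>UNIV. f (axis i 1))"
proof -
  have B: "Basis = range (\<lambda>i. axis i 1 :: real^'m)" by (auto simp: Basis_vec_def)
  have inj: "inj (\<lambda>i. axis i 1 :: real^'m)" by (auto simp: inj_on_def axis_eq_axis)
  show ?thesis by (simp only: B prod.reindex[OF inj] o_def)
qed

text \<open>Lebesgue measure is determined by its values on boxes, and a box in phase space pulls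
  back to a product of two boxes. This gives Fubini in position and frequency.\<close>

lemma lborel_phase_space:
  "(lborel :: (real^('n::finite + 'n)) measure) = distr (lborel \<Otimes>\<^sub>M lborel) borel (case_prod phase_point)"
proof (rule lborel_eqI)
  fix l u :: "real^('n::finite + 'n)"
  assume "\<And>b. b \<in> Basis \<Longrightarrow> l \<bullet> b \<le> u \<bullet> b"
  then have le: "l $ k \<le> u $ k" for k
    by (metis axis_in_Basis_iff cart_eq_inner_axis real_inner_1_right Basis_real_def singletonI)
  have le': "pos l \<bullet> b \<le> pos u \<bullet> b" "freq l \<bullet> b \<le> freq u \<bullet> b" if "b \<in> Basis" for b
    using that le by (auto simp: Basis_vec_def pos_def freq_def inner_axis)
  have "case_prod phase_point -` box l u = box (pos l) (pos u) \<times> box (freq l) (freq u)"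
    by (auto simp: mem_box_cart split_sum_all pos_def freq_def phase_point_def)
  then show "emeasure (distr (lborel \<Otimes>\<^sub>M lborel) borel (case_prod phase_point)) (box l u)
      = (\<Prod>b\<in>Basis. (u - l) \<bullet> b)"
    using le' le
    by (simp add: emeasure_distr lborel.emeasure_pair_measure_Times space_pair_measure prod_Basis_vec
        prod_UNIV_Plus inner_axis pos_def freq_def ennreal_mult prod_nonneg)
qed simp

lemma lborel_reflect:
  "lborel = distr lborel borel (\<lambda>x. c - x :: 'a::euclidean_space)"
  using lborel_affine[of "-1" c] by (simp add: density_1)

lemma
  fixes f :: "'a::euclidean_space \<Rightarrow> 'b::{banach, second_countable_topology}"
  assumes [measurable]: "f \<in> borel_measurable borel"
  shows integral_lborel_reflect: "(LINT x|lborel. f (c - x)) = integral\<^sup>L lborel f"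
    and integral_lborel_translate: "(LINT x|lborel. f (c + x)) = integral\<^sup>L lborel f"
    and integrable_lborel_translate: "integrable lborel (\<lambda>x. f (c + x)) \<longleftrightarrow> integrable lborel f"
proof -
  show "(LINT x|lborel. f (c - x)) = integral\<^sup>L lborel f"
    by (subst (2) lborel_reflect[of c]) (simp add: integral_distr)
  show "(LINT x|lborel. f (c + x)) = integral\<^sup>L lborel f"
    by (subst (2) lborel_distr_plus[of c, symmetric]) (simp add: integral_distr)
  show "integrable lborel (\<lambda>x. f (c + x)) \<longleftrightarrow> integrable lborel f"
    by (subst (2) lborel_distr_plus[of c, symmetric]) (simp add: integrable_distr_eq)
qed

section \<open>Square-integrable functions: integrability, sums and inner products\<close>

lemma L2_D [measurable_dest]: "f \<in> L2 \<Longrightarrow> f \<in> borel_measurable borel"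
  by (simp add: L2_def)

lemma L2_integrable: "f \<in> L2 \<Longrightarrow> integrable lborel (\<lambda>t. (cmod (f t))\<^sup>2)"
  by (simp add: L2_def)

lemma measurable_cnj [measurable (raw)]:
  assumes [measurable]: "f \<in> borel_measurable M"
  shows "(\<lambda>x. cnj (f x)) \<in> borel_measurable M"
  using borel_measurable_continuous_onI[OF continuous_on_cnj[OF continuous_on_id]] assms
  by (rule measurable_compose[rotated])

lemma measurable_cexp [measurable (raw)]:
  assumes [measurable]: "f \<in> borel_measurable M"
  shows "(\<lambda>x. exp (f x :: complex)) \<in> borel_measurable M"
  using borel_measurable_continuous_onI[OF continuous_on_exp[OF continuous_on_id]] assms
  by (rule measurable_compose[rotated])

text \<open>The pointwise arithmetic-geometric mean inequality, which does the work of
  Cauchy-Schwarz in the integrability arguments below.\<close>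

lemma cmod_mult_cnj_le: "cmod (x * cnj y) \<le> ((cmod x)\<^sup>2 + (cmod y)\<^sup>2) / 2"
  using zero_le_power2[of "cmod x - cmod y"] by (simp add: norm_mult power2_diff)

lemma integrable_L2_mult:
  assumes "f \<in> L2" "h \<in> L2"
  shows "integrable lborel (\<lambda>t. f t * cnj (h t))"
proof (rule Bochner_Integration.integrable_bound)
  show "integrable lborel (\<lambda>t. ((cmod (f t))\<^sup>2 + (cmod (h t))\<^sup>2) / 2)"
    using assms by (auto simp: L2_integrable)
  show "(\<lambda>t. f t * cnj (h t)) \<in> borel_measurable lborel"
    using assms by measurable
qed (intro AE_I2 order_trans[OF cmod_mult_cnj_le], simp)

lemma tf_shift_L2:
  assumes g: "g \<in> L2"
  shows "tf_shift l g \<in> L2"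
proof -
  have [measurable]: "g \<in> borel_measurable borel" using g by (rule L2_D)
  have "integrable lborel (\<lambda>t. (cmod (g (- pos l + t)))\<^sup>2)"
    using L2_integrable[OF g] by (subst integrable_lborel_translate) auto
  then show ?thesis
    by (auto simp: L2_def tf_shift_def norm_mult)
qed

lemma L2_add:
  assumes "f \<in> L2" "h \<in> L2"
  shows "(\<lambda>t. f t + h t) \<in> L2"
proof -
  have [measurable]: "f \<in> borel_measurable borel" "h \<in> borel_measurable borel" using assms by (auto dest: L2_D)
  have "integrable lborel (\<lambda>t. (cmod (f t + h t))\<^sup>2)"
  proof (rule Bochner_Integration.integrable_bound)
    show "integrable lborel (\<lambda>t. 2 * (cmod (f t))\<^sup>2 + 2 * (cmod (h t))\<^sup>2)"
      using assms by (auto simp: L2_integrable)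
    have "(cmod (x + y))\<^sup>2 \<le> 2 * (cmod x)\<^sup>2 + 2 * (cmod y)\<^sup>2" for x y
    proof -
      have "(cmod (x + y))\<^sup>2 \<le> (cmod x + cmod y)\<^sup>2" by (intro power_mono norm_triangle_ineq) auto
      also have "\<dots> \<le> 2 * (cmod x)\<^sup>2 + 2 * (cmod y)\<^sup>2"
        using zero_le_power2[of "cmod x - cmod y"] by (simp add: power2_diff power2_sum)
      finally show ?thesis .
    qed
    then show "AE t in lborel. norm ((cmod (f t + h t))\<^sup>2) \<le> norm (2 * (cmod (f t))\<^sup>2 + 2 * (cmod (h t))\<^sup>2)"
      by auto
  qed auto
  then show ?thesis by (simp add: L2_def)
qed

lemma L2_sum:
  assumes "\<And>k. k \<in> F \<Longrightarrow> f k \<in> L2"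
  shows "(\<lambda>t. \<Sum>k\<in>F. f k t) \<in> L2"
  using assms
proof (induction F rule: infinite_finite_induct)
  case (insert k F)
  then show ?case using L2_add[of "f k" "\<lambda>t. \<Sum>k\<in>F. f k t"] by simp
qed (simp_all add: L2_def)

lemma L2_inner_sum_left:
  assumes "\<And>k. k \<in> F \<Longrightarrow> f k \<in> L2" "h \<in> L2"
  shows "L2_inner (\<lambda>t. \<Sum>k\<in>F. f k t) h = (\<Sum>k\<in>F. L2_inner (f k) h)"
  unfolding L2_inner_def sum_distrib_right
  using assms by (intro Bochner_Integration.integral_sum integrable_L2_mult)

lemma L2_inner_cnj: "cnj (L2_inner f h) = L2_inner h f"
proof -
  have "cnj (L2_inner f h) = (LINT t|lborel. cnj (f t * cnj (h t)))"
    unfolding L2_inner_def by (rule Bochner_Integration.integral_cnj[symmetric])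
  also have "\<dots> = L2_inner h f"
    by (simp add: L2_inner_def mult.commute)
  finally show ?thesis .
qed

lemma L2_inner_self: "L2_inner f f = of_real ((L2_norm f)\<^sup>2)"
  unfolding L2_inner_def L2_norm_def complex_norm_square[symmetric] integral_complex_of_real
  by (simp add: real_sqrt_pow2_iff)

subsection \<open>Coherent states\<close>

definition symplectic_form :: "real^('n::finite + 'n) \<Rightarrow> real^('n::finite + 'n) \<Rightarrow> real" where
  "symplectic_form a b = freq a \<bullet> pos b - pos a \<bullet> freq b"

text \<open>The state \<open>\<rho>(z) h\<close>; the constant phase \<open>-pos z \<bullet> freq z / 2\<close> is the symmetric normalisation.\<close>

definition coherent :: "real^('n::finite + 'n) \<Rightarrow> real^'n \<Rightarrow> complex" where
  "coherent z t = exp (of_real (- pi * (norm (t - pos z))\<^sup>2)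
     + 2 * pi * \<i> * of_real (freq z \<bullet> t - pos z \<bullet> freq z / 2))"

lemma measurable_coherent [measurable]: "coherent z \<in> borel_measurable borel"
  unfolding coherent_def[abs_def] by measurable

lemma cnj_cexp_phase: "cnj (exp (of_real r + 2 * pi * \<i> * of_real s)) = exp (of_real r + 2 * pi * \<i> * of_real (- s))"
  by (simp add: exp_cnj)

lemma mult_exp_phase:
  "exp (of_real r + 2 * pi * \<i> * of_real s) * exp (of_real r' + 2 * pi * \<i> * of_real s')
   = exp (of_real (r + r') + 2 * pi * \<i> * of_real (s + s'))"
  by (simp add: mult_exp_exp algebra_simps)

text \<open>Completing the square: two Gaussians centred at \<open>pos a\<close> and
  \<open>pos b\<close> multiply to a Gaussian about the midpoint \<open>p\<close>, modulated by the
  frequency difference \<open>\<xi>\<close>; \<open>r\<close> and \<open>s\<close> collect what does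
  not depend on \<open>t\<close>.\<close>

lemma has_bochner_integral_coherent:
  fixes a b :: "real^('n::finite + 'n)"
  shows "has_bochner_integral lborel (\<lambda>t. coherent a t * cnj (coherent b t))
    (exp (of_real (- pi / 2 * (norm (a - b))\<^sup>2) + 2 * pi * \<i> * of_real (symplectic_form a b / 2)) / of_real (sqrt 2 ^ CARD('n)))"
proof -
  define p where "p = (1/2) *\<^sub>R (pos a + pos b)"
  define \<xi> where "\<xi> = freq a - freq b"
  define r where "r = - pi / 2 * (norm (pos a - pos b))\<^sup>2"
  define s where "s = (pos b \<bullet> freq b - pos a \<bullet> freq a) / 2"
  have eq: "coherent a t * cnj (coherent b t) = exp (of_real r + 2 * pi * \<i> * of_real s) *
      exp (of_real (- pi * 2 * (norm (t - p))\<^sup>2) + 2 * pi * \<i> * of_real (\<xi> \<bullet> t))" for t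
  proof -
    have "- pi * (norm (t - pos a))\<^sup>2 + - pi * (norm (t - pos b))\<^sup>2 = r + - pi * 2 * (norm (t - p))\<^sup>2"
      unfolding r_def p_def power2_norm_eq_inner
      by (simp add: inner_diff_left inner_diff_right inner_add_left inner_add_right inner_commute algebra_simps)
    moreover have "freq a \<bullet> t - pos a \<bullet> freq a / 2 + - (freq b \<bullet> t - pos b \<bullet> freq b / 2) = s + \<xi> \<bullet> t"
      by (simp add: s_def \<xi>_def inner_diff_left field_simps)
    ultimately show ?thesis
      unfolding coherent_def cnj_cexp_phase mult_exp_phase by (simp only:)
  qed
  have val: "exp (of_real r + 2 * pi * \<i> * of_real s) *
     (exp (of_real (- pi * (norm \<xi>)\<^sup>2 / 2) + 2 * pi * \<i> * of_real (\<xi> \<bullet> p)) / of_real (sqrt 2 ^ CARD('n)))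
     = exp (of_real (- pi / 2 * (norm (a - b))\<^sup>2) + 2 * pi * \<i> * of_real (symplectic_form a b / 2)) / of_real (sqrt 2 ^ CARD('n))"
  proof -
    have "r + - pi * (norm \<xi>)\<^sup>2 / 2 = - pi / 2 * (norm (a - b))\<^sup>2"
      by (simp add: norm_phase_space[of "a - b"] pos_diff freq_diff r_def \<xi>_def algebra_simps)
    moreover have "s + \<xi> \<bullet> p = symplectic_form a b / 2"
      by (simp add: s_def \<xi>_def p_def symplectic_form_def inner_diff_left inner_diff_right inner_add_right inner_commute field_simps)
    ultimately show ?thesis
      unfolding times_divide_eq_right mult_exp_phase by (simp only:)
  qed
  show ?thesis
    using has_bochner_integral_mult_right[OF has_bochner_integral_gaussian[of 2 p \<xi>],
        of "exp (of_real r + 2 * pi * \<i> * of_real s)"]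
    unfolding eq by (simp only: val DIM_cart DIM_real mult_1_right)
qed

lemma L2_inner_coherent:
  "L2_inner (coherent a) (coherent b)
   = exp (of_real (- pi / 2 * (norm (a - b))\<^sup>2) + 2 * pi * \<i> * of_real (symplectic_form a b / 2)) / of_real (sqrt 2 ^ CARD('n))"
  for a b :: "real^('n::finite + 'n)"
  using has_bochner_integral_coherent[of a b] by (simp only: L2_inner_def has_bochner_integral_iff)

lemma coherent_L2: "coherent z \<in> L2"
proof -
  have "integrable lborel (\<lambda>t. cmod (coherent z t * cnj (coherent z t)))"
    using has_bochner_integral_coherent[of z z] by (intro integrable_norm) (simp only: has_bochner_integral_iff)
  then show ?thesis
    by (simp add: L2_def norm_mult power2_eq_square)
qed

text \<open>Covariance, by translating the integration variable by \<open>pos \<mu>\<close>. The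
  phase has one part from the symplectic form and one depending on \<open>\<mu>\<close> alone, since
  \<open>tf_shift\<close> is not symmetrically normalised.\<close>

lemma L2_inner_coherent_tf_shift:
  assumes "g \<in> L2"
  shows "L2_inner (coherent \<nu>) (tf_shift \<mu> g)
    = exp (2 * pi * \<i> * of_real ((symplectic_form \<nu> \<mu> - pos \<mu> \<bullet> freq \<mu>) / 2)) * L2_inner (coherent (\<nu> - \<mu>)) g"
proof -
  have [measurable]: "g \<in> borel_measurable borel" using assms by (rule L2_D)
  have [measurable]: "tf_shift \<mu> g \<in> borel_measurable borel" using tf_shift_L2[OF assms] by (rule L2_D)
  have "L2_inner (coherent \<nu>) (tf_shift \<mu> g)
      = (LINT t|lborel. coherent \<nu> (pos \<mu> + t) * cnj (tf_shift \<mu> g (pos \<mu> + t)))"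
    unfolding L2_inner_def 
    by (rule integral_lborel_translate[of "\<lambda>t. coherent \<nu> t * cnj (tf_shift \<mu> g t)" "pos \<mu>", symmetric]) measurable
  also have "\<dots> = (LINT t|lborel. exp (2 * pi * \<i> * of_real ((symplectic_form \<nu> \<mu> - pos \<mu> \<bullet> freq \<mu>) / 2))
      * (coherent (\<nu> - \<mu>) t * cnj (g t)))"
  proof (rule Bochner_Integration.integral_cong[OF refl])
    fix t
    have "freq \<nu> \<bullet> (pos \<mu> + t) - pos \<nu> \<bullet> freq \<nu> / 2 + - (freq \<mu> \<bullet> (pos \<mu> + t))
       = (symplectic_form \<nu> \<mu> - pos \<mu> \<bullet> freq \<mu>) / 2 + (freq (\<nu> - \<mu>) \<bullet> t - pos (\<nu> - \<mu>) \<bullet> freq (\<nu> - \<mu>) / 2)"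
      unfolding symplectic_form_def pos_diff freq_diff inner_diff_left inner_diff_right inner_add_right
        inner_commute[of "pos \<mu>" "freq \<nu>"] inner_commute[of "pos \<mu>" "freq \<mu>"]
      by (simp add: field_simps)
    moreover have "pos \<mu> + t - pos \<nu> = t - pos (\<nu> - \<mu>)"
      by (simp add: pos_diff)
    ultimately have "coherent \<nu> (pos \<mu> + t) * cnj (exp (of_real 0 + 2 * pi * \<i> * of_real (freq \<mu> \<bullet> (pos \<mu> + t))))
      = exp (of_real 0 + 2 * pi * \<i> * of_real ((symplectic_form \<nu> \<mu> - pos \<mu> \<bullet> freq \<mu>) / 2)) * coherent (\<nu> - \<mu>) t"
      unfolding coherent_def cnj_cexp_phase mult_exp_phase by (simp only: add_0_left add_0_right)
    then show "coherent \<nu> (pos \<mu> + t) * cnj (tf_shift \<mu> g (pos \<mu> + t))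
      = exp (2 * pi * \<i> * of_real ((symplectic_form \<nu> \<mu> - pos \<mu> \<bullet> freq \<mu>) / 2)) * (coherent (\<nu> - \<mu>) t * cnj (g t))"
      by (simp add: tf_shift_def mult.assoc[symmetric])
  qed
  also have "\<dots> = exp (2 * pi * \<i> * of_real ((symplectic_form \<nu> \<mu> - pos \<mu> \<bullet> freq \<mu>) / 2)) * L2_inner (coherent (\<nu> - \<mu>)) g"
    by (simp add: L2_inner_def)
  finally show ?thesis .
qed

text \<open>The symmetric normalising phase is even in \<open>z\<close>, so reflecting
  \<open>t\<close> turns \<open>coherent (- z)\<close> into exactly
  \<open>coherent z\<close>.\<close>

lemma L2_inner_coherent_odd:
  assumes "g \<in> L2" "\<And>t. g t = - g (- t)"
  shows "L2_inner (coherent (- z)) g = - L2_inner (coherent z) g"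
proof -
  have [measurable]: "g \<in> borel_measurable borel" using assms(1) by (rule L2_D)
  have "coherent (- z) (0 - t) = coherent z t" for t
    using norm_minus_commute[of t "pos z"] by (simp add: coherent_def pos_minus freq_minus)
  moreover have "g (0 - t) = - g t" for t
    using assms(2)[of t] by simp
  moreover have "L2_inner (coherent (- z)) g = (LINT t|lborel. coherent (- z) (0 - t) * cnj (g (0 - t)))"
    unfolding L2_inner_def 
    by (rule integral_lborel_reflect[of "\<lambda>t. coherent (- z) t * cnj (g t)" 0, symmetric]) measurable
  ultimately show ?thesis
    by (simp add: L2_inner_def)
qed

subsection \<open>Products of Gaussian coefficients\<close>

text \<open>
  This is the complex conjugate of the short-time Fourier transform of \<open>\<rho>(a) h\<close> with window \<open>\<rho>(b) h\<close>,
  written out so that its Fourier inversion in the frequency variable is a Gaussian integral.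
\<close>

definition ambig_kernel :: "real^('n::finite + 'n) \<Rightarrow> real^('n::finite + 'n) \<Rightarrow> real^('n::finite + 'n) \<Rightarrow> complex" where
  "ambig_kernel a b z =
     exp (of_real (- pi / 2 * (norm (z - (a - b)))\<^sup>2) + 2 * pi * \<i> * of_real
       ((1/2) *\<^sub>R (pos a + pos b + pos z) \<bullet> (freq z - (freq a - freq b))
        + pos a \<bullet> freq a / 2 - pos b \<bullet> freq b / 2 - freq b \<bullet> pos z)) / of_real (sqrt 2 ^ CARD('n))"

lemma measurable_ambig_kernel [measurable]: "ambig_kernel a b \<in> borel_measurable borel"
  unfolding ambig_kernel_def[abs_def] by measurable

lemma norm_ambig_kernel:
  "cmod (ambig_kernel a b z) = exp (- pi / 2 * (norm (z - (a - b)))\<^sup>2) / sqrt 2 ^ CARD('n)"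
  for a b z :: "real^('n::finite + 'n)"
  by (simp add: ambig_kernel_def norm_divide norm_power)

lemma integrable_ambig_kernel: "integrable lborel (\<lambda>z. cmod (ambig_kernel a b z))"
proof -
  have "integrable lborel (\<lambda>z. cmod (exp (of_real (- pi * (1/2) * (norm (z - (a - b)))\<^sup>2) + 2 * pi * \<i> * of_real (0 \<bullet> z))))"
    using has_bochner_integral_gaussian[of "1/2" "a - b" 0]
    by (intro integrable_norm) (simp only: has_bochner_integral_iff)
  then show ?thesis
    unfolding norm_ambig_kernel by simp
qed

text \<open>As a function of the frequency, the integrand is a Gaussian centred at \<open>q\<close>
  with modulation \<open>p - t\<close>; its integral splits again into the two coherent
  states.\<close>

lemma integral_freq_ambig_kernel:
  "(LINT \<omega>|lborel. ambig_kernel a b (phase_point x \<omega>) * exp (of_real 0 + 2 * pi * \<i> * of_real (- (\<omega> \<bullet> t))))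
   = cnj (coherent a t) * coherent b (t - x)"
  for a b :: "real^('n::finite + 'n)"
proof -
  define p where "p = (1/2) *\<^sub>R (pos a + pos b + x)"
  define q where "q = freq a - freq b"
  define r where "r = - pi / 2 * (norm (x - (pos a - pos b)))\<^sup>2"
  define s where "s = - (p \<bullet> q) + pos a \<bullet> freq a / 2 - pos b \<bullet> freq b / 2 - freq b \<bullet> x"
  have eq: "ambig_kernel a b (phase_point x \<omega>) * exp (of_real 0 + 2 * pi * \<i> * of_real (- (\<omega> \<bullet> t)))
     = exp (of_real r + 2 * pi * \<i> * of_real s) / of_real (sqrt 2 ^ CARD('n)) *
      exp (of_real (- pi * (1/2) * (norm (\<omega> - q))\<^sup>2) + 2 * pi * \<i> * of_real ((p - t) \<bullet> \<omega>))" for \<omega>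
  proof -
    have n: "(norm (phase_point x \<omega> - (a - b)))\<^sup>2 = (norm (x - (pos a - pos b)))\<^sup>2 + (norm (\<omega> - q))\<^sup>2"
      by (simp add: norm_phase_space[of "phase_point x \<omega> - (a - b)"] pos_diff freq_diff q_def)
    have "- pi / 2 * (norm (phase_point x \<omega> - (a - b)))\<^sup>2 + 0 = r + - pi * (1/2) * (norm (\<omega> - q))\<^sup>2"
      unfolding n r_def by (simp add: algebra_simps)
    moreover have "p \<bullet> (\<omega> - q) + pos a \<bullet> freq a / 2 - pos b \<bullet> freq b / 2 - freq b \<bullet> x + - (\<omega> \<bullet> t) = s + (p - t) \<bullet> \<omega>"
      by (simp add: s_def inner_diff_left inner_diff_right inner_commute)
    ultimately show ?thesis
      unfolding ambig_kernel_def times_divide_eq_left mult_exp_phase pos_phase_point freq_phase_point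
        p_def[symmetric] q_def[symmetric] by (simp only:)
  qed
  have "r + - pi * (norm (p - t))\<^sup>2 / (1/2) = - pi * (norm (t - pos a))\<^sup>2 + - pi * (norm (t - x - pos b))\<^sup>2"
    unfolding r_def p_def power2_norm_eq_inner
    by (simp add: inner_diff_left inner_diff_right inner_add_left inner_add_right inner_commute algebra_simps)
  moreover have "s + (p - t) \<bullet> q = - (freq a \<bullet> t - pos a \<bullet> freq a / 2) + (freq b \<bullet> (t - x) - pos b \<bullet> freq b / 2)"
    by (simp add: s_def q_def inner_diff_left inner_diff_right inner_commute)
  ultimately have "exp (of_real r + 2 * pi * \<i> * of_real s)
      * exp (of_real (- pi * (norm (p - t))\<^sup>2 / (1/2)) + 2 * pi * \<i> * of_real ((p - t) \<bullet> q))
      = cnj (coherent a t) * coherent b (t - x)"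
    unfolding coherent_def cnj_cexp_phase mult_exp_phase by (simp only:)
  \<comment> \<open>The normalisation of the kernel cancels the factor produced by a Gaussian
    integral of parameter 1/2.\<close>
  moreover have "complex_of_real (sqrt 2 ^ CARD('n)) * of_real (sqrt (1/2) ^ DIM(real^'n)) = 1"
    by (simp flip: of_real_mult power_mult_distrib real_sqrt_mult)
  moreover have "x / c * (y / d) = x * y" if "c * d = 1" for x y c d :: complex
    using that by (simp add: times_divide_times_eq)
  ultimately have val: "exp (of_real r + 2 * pi * \<i> * of_real s) / of_real (sqrt 2 ^ CARD('n))
      * (exp (of_real (- pi * (norm (p - t))\<^sup>2 / (1/2)) + 2 * pi * \<i> * of_real ((p - t) \<bullet> q)) / of_real (sqrt (1/2) ^ DIM(real^'n)))
      = cnj (coherent a t) * coherent b (t - x)"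
    by simp
  show ?thesis
    unfolding eq val[symmetric]
    by (intro has_bochner_integral_integral_eq has_bochner_integral_mult_right has_bochner_integral_gaussian) simp
qed

lemma integral_phase_space:
  fixes f :: "real^('n::finite + 'n) \<Rightarrow> complex"
  assumes "integrable lborel f"
  shows "integral\<^sup>L lborel f = (LINT x|lborel. LINT \<omega>|lborel. f (phase_point x \<omega>))"
proof -
  have [measurable]: "f \<in> borel_measurable borel" using assms by auto
  have "integrable (lborel \<Otimes>\<^sub>M lborel) (\<lambda>y. f (case y of (x, \<omega>) \<Rightarrow> phase_point x \<omega>))"
    using assms by (subst (asm) lborel_phase_space, subst (asm) integrable_distr_eq) auto
  then have "(LINT y|(lborel \<Otimes>\<^sub>M lborel). f (case y of (x, \<omega>) \<Rightarrow> phase_point x \<omega>))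
      = (LINT x|lborel. LINT \<omega>|lborel. f (phase_point x \<omega>))"
    using lborel_pair.integral_fst'[of "\<lambda>y. f (case y of (x, \<omega>) \<Rightarrow> phase_point x \<omega>)"] by simp
  then show ?thesis
    by (subst lborel_phase_space, subst integral_distr) auto
qed

text \<open>An instance of Moyal's formula: write \<open>stft\<close> as an integral over
  \<open>t\<close>, exchange the integrals and apply the frequency inversion.\<close>

lemma L2_inner_coherent_product:
  assumes "g \<in> L2"
  shows "L2_inner g (coherent a) * cnj (L2_inner g (coherent b))
    = (LINT z|lborel. ambig_kernel a b z * stft g g z)"
proof -
  have [measurable]: "g \<in> borel_measurable borel" using assms by (rule L2_D)
  define f where "f z t = ambig_kernel a b z * (g t * cnj (tf_shift z g t))" for z t
  have f_meas [measurable]: "case_prod f \<in> borel_measurable (lborel \<Otimes>\<^sub>M lborel)"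
    unfolding f_def tf_shift_def by measurable
  have tf_int: "integrable lborel (\<lambda>t. (cmod (tf_shift z g t))\<^sup>2)"
    "(LINT t|lborel. (cmod (tf_shift z g t))\<^sup>2) = (LINT t|lborel. (cmod (g t))\<^sup>2)" for z
  proof -
    show "integrable lborel (\<lambda>t. (cmod (tf_shift z g t))\<^sup>2)"
      by (rule L2_integrable[OF tf_shift_L2[OF assms]])
    show "(LINT t|lborel. (cmod (tf_shift z g t))\<^sup>2) = (LINT t|lborel. (cmod (g t))\<^sup>2)"
      using integral_lborel_translate[of "\<lambda>t. (cmod (g t))\<^sup>2" "- pos z"]
      by (simp add: tf_shift_def norm_mult)
  qed
  have f_int: "integrable lborel (f z)" for z
    unfolding f_def[abs_def]
    by (intro integrable_mult_right integrable_L2_mult tf_shift_L2 assms)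
  define G where "G = (LINT t|lborel. (cmod (g t))\<^sup>2)"
  \<comment> \<open>The norm of \<open>tf_shift z g\<close> does not depend on \<open>z\<close>, so
    the kernel alone controls the inner integral; its Gaussian decay then justifies Fubini.\<close>
  have le: "(LINT t|lborel. cmod (f z t)) \<le> cmod (ambig_kernel a b z) * G" for z
  proof -
    have "(LINT t|lborel. cmod (f z t)) \<le>
        (LINT t|lborel. cmod (ambig_kernel a b z) * (((cmod (g t))\<^sup>2 + (cmod (tf_shift z g t))\<^sup>2) / 2))"
    proof (rule integral_mono)
      show "integrable lborel (\<lambda>t. cmod (ambig_kernel a b z) * (((cmod (g t))\<^sup>2 + (cmod (tf_shift z g t))\<^sup>2) / 2))"
        using L2_integrable[OF assms] tf_int(1) by auto
      show "cmod (f z t) \<le> cmod (ambig_kernel a b z) * (((cmod (g t))\<^sup>2 + (cmod (tf_shift z g t))\<^sup>2) / 2)" for t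
        unfolding f_def norm_mult[of "ambig_kernel a b z"] by (intro mult_left_mono cmod_mult_cnj_le norm_ge_zero)
    qed (use f_int in auto)
    also have "\<dots> = cmod (ambig_kernel a b z) * G"
      using L2_integrable[OF assms] tf_int by (simp add: G_def)
    finally show ?thesis .
  qed
  have int: "integrable (lborel \<Otimes>\<^sub>M lborel) (case_prod f)"
  proof (rule lborel_pair.Fubini_integrable)
    show "integrable lborel (\<lambda>z. LINT t|lborel. norm (case (z, t) of (z, t) \<Rightarrow> f z t))"
    proof (rule Bochner_Integration.integrable_bound)
      show "integrable lborel (\<lambda>z. cmod (ambig_kernel a b z) * G)"
        by (intro integrable_mult_left integrable_ambig_kernel)
      show "AE z in lborel. norm (LINT t|lborel. norm (case (z, t) of (z, t) \<Rightarrow> f z t))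
          \<le> norm (cmod (ambig_kernel a b z) * G)"
        using le by (auto intro!: AE_I2 simp: G_def)
    qed measurable
  qed (use f_int in auto)
  \<comment> \<open>Fubini provides integrable slices only for almost every \<open>t\<close>, which
    suffices under the outer integral.\<close>
  have inner: "(LINT z|lborel. f z t) = g t * cnj (coherent a t) * cnj (L2_inner g (coherent b))"
    if "integrable lborel (\<lambda>z. f z t)" for t
  proof -
    have "(LINT z|lborel. f z t) = (LINT x|lborel. LINT \<omega>|lborel. f (phase_point x \<omega>) t)"
      by (rule integral_phase_space[OF that])
    also have "\<dots> = (LINT x|lborel. g t * cnj (coherent a t) * (coherent b (t - x) * cnj (g (t - x))))"
    proof (rule Bochner_Integration.integral_cong[OF refl])
      fix x
      have "f (phase_point x \<omega>) t = g t * cnj (g (t - x)) *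
         (ambig_kernel a b (phase_point x \<omega>) * exp (of_real 0 + 2 * pi * \<i> * of_real (- (\<omega> \<bullet> t))))" for \<omega>
        by (simp add: f_def tf_shift_def exp_cnj)
      then have "(LINT \<omega>|lborel. f (phase_point x \<omega>) t)
          = g t * cnj (g (t - x)) * (cnj (coherent a t) * coherent b (t - x))"
        by (simp only: integral_mult_right_zero integral_freq_ambig_kernel)
      then show "(LINT \<omega>|lborel. f (phase_point x \<omega>) t)
          = g t * cnj (coherent a t) * (coherent b (t - x) * cnj (g (t - x)))"
        by (simp only: mult_ac)
    qed
    also have "\<dots> = g t * cnj (coherent a t) * (LINT x|lborel. coherent b (t - x) * cnj (g (t - x)))"
      by (rule integral_mult_right_zero)
    also have "(LINT x|lborel. coherent b (t - x) * cnj (g (t - x))) = L2_inner (coherent b) g"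
      unfolding L2_inner_def
      by (rule integral_lborel_reflect[of "\<lambda>x. coherent b x * cnj (g x)" t]) measurable
    finally show ?thesis by (simp only: L2_inner_cnj)
  qed
  have "(LINT z|lborel. ambig_kernel a b z * stft g g z) = (LINT z|lborel. LINT t|lborel. f z t)"
    by (simp add: f_def stft_def L2_inner_def)
  also have "\<dots> = (LINT t|lborel. LINT z|lborel. f z t)"
    by (rule lborel_pair.Fubini_integral[OF int, symmetric])
  also have "\<dots> = (LINT t|lborel. g t * cnj (coherent a t) * cnj (L2_inner g (coherent b)))"
    using lborel_pair.AE_integrable_snd[OF int]
    by (intro integral_cong_AE) (auto simp: inner)
  also have "\<dots> = L2_inner g (coherent a) * cnj (L2_inner g (coherent b))"
    by (simp add: L2_inner_def)
  finally show ?thesis by simp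
qed

subsection \<open>Odd sequences on the integer lattice\<close>

lemma vec_box_eq_image: "{k :: 'a^'m. \<forall>i. k $ i \<in> A} = vec_lambda ` (UNIV \<rightarrow>\<^sub>E A)"
proof (intro equalityI subsetI)
  fix k :: "'a^'m" assume "k \<in> {k. \<forall>i. k $ i \<in> A}"
  then show "k \<in> vec_lambda ` (UNIV \<rightarrow>\<^sub>E A)"
    by (intro image_eqI[of _ _ "vec_nth k"]) auto
qed auto

lemma
  assumes "finite A"
  shows finite_vec_box: "finite {k :: 'a^'m. \<forall>i. k $ i \<in> A}"
    and card_vec_box: "card {k :: 'a^'m. \<forall>i. k $ i \<in> A} = card A ^ CARD('m)"
proof -
  show "finite {k :: 'a^'m. \<forall>i. k $ i \<in> A}"
    unfolding vec_box_eq_image using assms by (intro finite_imageI finite_PiE) auto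
  have "inj_on vec_lambda (UNIV \<rightarrow>\<^sub>E A :: ('m \<Rightarrow> 'a) set)"
    by (rule inj_onI) (simp add: vec_lambda_inject)
  then show "card {k :: 'a^'m. \<forall>i. k $ i \<in> A} = card A ^ CARD('m)"
    unfolding vec_box_eq_image by (simp add: card_image card_PiE)
qed

lemma infsum_compl_small:
  fixes f :: "'a \<Rightarrow> real"
  assumes "f summable_on UNIV" "\<And>x. 0 \<le> f x" "\<epsilon> > 0"
  obtains K where "finite K" "infsum f (- K) \<le> \<epsilon>"
proof -
  obtain K where K: "finite K" "dist (sum f K) (infsum f UNIV) \<le> \<epsilon>"
    using infsum_finite_approximation[OF assms(1,3)] by auto
  have "infsum f UNIV = infsum f K + infsum f (- K)"
    using assms(1) summable_on_subset_banach[OF assms(1)] infsum_Un_disjoint[of f K "-K"] by (simp add: Compl_partition)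
  with K show ?thesis
    by (intro that[of K]) (auto simp: dist_real_def)
qed

text \<open>The sum equals its own negative; for a family that is not summable, the default value 0
  of \<open>infsum\<close> agrees.\<close>

lemma antisymmetric_sum_eq_0:
  fixes f :: "'a::ab_group_add \<Rightarrow> complex"
  assumes "\<And>k. f (c - k) = - f k"
  shows "infsum f UNIV = 0"
proof -
  have "infsum f UNIV = (\<Sum>\<^sub>\<infinity>k. - f k)"
    by (rule infsum_reindex_bij_witness[of _ "\<lambda>k. c - k" "\<lambda>k. c - k"]) (auto simp: assms)
  also have "\<dots> = - infsum f UNIV"
    by (rule infsum_uminus)
  finally show ?thesis
    by (simp add: eq_neg_iff_add_eq_0 flip: mult_2)
qed

lemma
  fixes f :: "'a::ab_group_add \<Rightarrow> real"
  shows summable_on_reflect_iff: "(\<lambda>m. f (c - m)) summable_on UNIV \<longleftrightarrow> f summable_on UNIV"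
    and infsum_reflect: "(\<Sum>\<^sub>\<infinity>m. f (c - m)) = infsum f UNIV"
proof -
  show "(\<lambda>m. f (c - m)) summable_on UNIV \<longleftrightarrow> f summable_on UNIV"
    by (rule summable_on_reindex_bij_witness[of _ "\<lambda>k. c - k" "\<lambda>k. c - k"]) auto
  show "(\<Sum>\<^sub>\<infinity>m. f (c - m)) = infsum f UNIV"
    by (rule infsum_reindex_bij_witness[of _ "\<lambda>k. c - k" "\<lambda>k. c - k"]) auto
qed

lemma has_sum_finite_sum:
  fixes f :: "'k \<Rightarrow> 'a \<Rightarrow> 'b::topological_comm_monoid_add"
  assumes "\<And>k. k \<in> F \<Longrightarrow> (f k has_sum s k) A"
  shows "((\<lambda>x. \<Sum>k\<in>F. f k x) has_sum (\<Sum>k\<in>F. s k)) A"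
  using assms by (induction F rule: infinite_finite_induct) (auto intro: has_sum_add)

lemma double_eq_iff_int_vec: "k + k = l + l \<longleftrightarrow> k = (l :: int^'m)"
  by (auto simp: vec_eq_iff)

text \<open>
  The substitution \<open>k \<mapsto> m - k\<close> reverses the sign of every term, so the sum over all \<open>k\<close> vanishes, and a
  truncation to a box is only large for \<open>m / 2\<close> near the boundary of the box.
\<close>

lemma odd_sequence_box_estimate:
  fixes \<psi> :: "int^'m \<Rightarrow> complex" and e :: "int^'m \<Rightarrow> int^'m \<Rightarrow> complex" and \<delta> :: real
  assumes sum: "(\<lambda>m. cmod (\<psi> m)) summable_on UNIV"
    and odd: "\<And>m. \<psi> (- m) = - \<psi> m"
    and e_le: "\<And>k m. cmod (e k m) \<le> 1"
    and e_sym: "\<And>k m. e (m - k) m = e k m"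
    and "\<delta> > 0"
  obtains F where "finite F" "F \<noteq> {}"
    "(\<Sum>\<^sub>\<infinity>m. (cmod (\<Sum>k\<in>F. e k m * \<psi> (k + k - m)))\<^sup>2) \<le> \<delta> * card F"
proof -
  define a where "a m = cmod (\<psi> m)" for m
  define C where "C = infsum a UNIV"
  have a0: "a m \<ge> 0" for m by (simp add: a_def)
  have asum: "a summable_on A" for A
    using summable_on_subset_banach[OF sum] by (auto simp: a_def[abs_def])
  have C0: "C \<ge> 0" by (simp add: C_def infsum_nonneg a0)
  have a_even: "a (- m) = a m" for m by (simp add: a_def odd)
  \<comment> \<open>Injectivity bounds sums along the points 2k - m by sums of \<open>a\<close> over
    a set containing these points.\<close>
  have inj: "inj_on (\<lambda>k. k + k - m) A" for m :: "int^'m" and A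
    by (rule inj_onI) (metis diff_add_cancel double_eq_iff_int_vec)
  have sub_sum: "(\<lambda>k. a (k + k - m)) summable_on A" for m A
    using summable_on_reindex[OF inj, of a m A] asum by (simp add: o_def)
  have sub_le: "(\<Sum>\<^sub>\<infinity>k\<in>A. a (k + k - m)) \<le> infsum a B" if "\<And>k. k \<in> A \<Longrightarrow> k + k - m \<in> B" for m A B
  proof -
    have "(\<Sum>\<^sub>\<infinity>k\<in>A. a (k + k - m)) = infsum a ((\<lambda>k. k + k - m) ` A)"
      unfolding infsum_reindex[OF inj] o_def ..
    also have "\<dots> \<le> infsum a B"
      using that by (intro infsum_mono2 asum a0) auto
    finally show ?thesis .
  qed
  have term_le: "cmod (e k m * \<psi> (k + k - m)) \<le> a (k + k - m)" for k m
    using mult_right_mono[OF e_le, of "a (k+k-m)"] by (simp add: norm_mult a_def)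
  have term_abs: "(\<lambda>k. norm (e k m * \<psi> (k + k - m))) summable_on A" for m A
    by (rule Infinite_Sum.abs_summable_on_comparison_test'[OF sub_sum term_le])
  have norm_inf: "cmod (\<Sum>\<^sub>\<infinity>k\<in>A. e k m * \<psi> (k + k - m)) \<le> infsum a B"
    if "\<And>k. k \<in> A \<Longrightarrow> k + k - m \<in> B" for m A B
  proof -
    have "cmod (\<Sum>\<^sub>\<infinity>k\<in>A. e k m * \<psi> (k + k - m)) \<le> (\<Sum>\<^sub>\<infinity>k\<in>A. a (k + k - m))"
      by (rule norm_infsum_le[OF has_sum_infsum[OF Infinite_Sum.abs_summable_summable[OF term_abs]]
            has_sum_infsum[OF sub_sum] term_le])
    with sub_le[OF that] show ?thesis by (meson order_trans)
  qed
  \<comment> \<open>An interior point of the box will cost at most 2 \<epsilon> C, hence at most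
    half of \<open>\<delta>\<close>; the summand 4 keeps the denominator positive when
    \<open>C\<close> is 0.\<close>
  define \<epsilon> where "\<epsilon> = \<delta> / (4 * C + 4)"
  have \<epsilon>: "\<epsilon> > 0" "2 * \<epsilon> * C \<le> \<delta> / 2"
    using C0 \<open>\<delta> > 0\<close> by (auto simp: \<epsilon>_def field_simps)
  obtain K where K: "finite K" "infsum a (- K) \<le> \<epsilon>"
    using infsum_compl_small[OF asum a0 \<epsilon>(1)] by blast
  \<comment> \<open>\<open>R\<close> bounds every coordinate of every point of \<open>K\<close>, so
    the cube \<open>X\<close> contains \<open>K\<close> and the tail of \<open>a\<close> outside
    \<open>X\<close> is at most \<open>\<epsilon>\<close>.\<close>
  define R where "R = (\<Sum>k\<in>K. \<Sum>i\<in>UNIV. \<bar>k $ i\<bar>)"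
  have R0: "R \<ge> 0" unfolding R_def by (intro sum_nonneg) auto
  define X where "X = {m :: int^'m. \<forall>i. \<bar>m $ i\<bar> \<le> R}"
  have "K \<subseteq> X"
  proof
    fix k assume "k \<in> K"
    have "\<bar>k $ i\<bar> \<le> R" for i
    proof -
      have "\<bar>k $ i\<bar> \<le> (\<Sum>i\<in>UNIV. \<bar>k $ i\<bar>)" by (rule member_le_sum) auto
      also have "\<dots> \<le> R" unfolding R_def
        by (rule member_le_sum[OF \<open>k \<in> K\<close>]) (auto simp: K intro: sum_nonneg)
      finally show ?thesis .
    qed
    then show "k \<in> X" by (simp add: X_def)
  qed
  then have X: "infsum a (- X) \<le> \<epsilon>"
    using K(2) infsum_mono2[of a "-X" "-K"] asum a0 by force
  \<comment> \<open>The proportion of a box of side \<open>N\<close> lying within \<open>R\<close>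
    of its faces tends to 0, so a cost of C^2 for each such point is eventually below half of
    \<open>\<delta>\<close> per point of the box.\<close>
  have "(\<lambda>N. 2 * of_int R / real N) \<longlonglongrightarrow> 0"
    by (rule lim_const_over_n)
  then have "(\<lambda>N. C\<^sup>2 * (1 - (1 - 2 * of_int R / real N) ^ CARD('m))) \<longlonglongrightarrow> C\<^sup>2 * (1 - (1 - 0) ^ CARD('m))"
    by (intro tendsto_mult tendsto_diff tendsto_power tendsto_const)
  then have "\<forall>\<^sub>F N in sequentially. C\<^sup>2 * (1 - (1 - 2 * of_int R / real N) ^ CARD('m)) < \<delta> / 2"
    using \<open>\<delta> > 0\<close> by (intro order_tendstoD(2)) auto
  then have "\<forall>\<^sub>F N in sequentially. C\<^sup>2 * (1 - (1 - 2 * of_int R / real N) ^ CARD('m)) < \<delta> / 2 \<and> N > nat (2 * R)"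
    by (rule eventually_conj[OF _ eventually_gt_at_top])
  then obtain N where N: "C\<^sup>2 * (1 - (1 - 2 * of_int R / real N) ^ CARD('m)) < \<delta> / 2" "N > nat (2 * R)"
    by (auto dest!: eventually_happens simp del: eventually_sequentially)
  then have NR: "2 * R < int N" "N > 0" by auto
  \<comment> \<open>\<open>F\<close> is the box and \<open>I\<close> its interior at depth
    \<open>R\<close>.\<close>
  define F where "F = {k :: int^'m. \<forall>i. k $ i \<in> {0..<int N}}"
  define I where "I = {k :: int^'m. \<forall>i. k $ i \<in> {R..<int N - R}}"
  have F: "finite F" "card F = N ^ CARD('m)"
    unfolding F_def by (simp_all add: finite_vec_box card_vec_box del: atLeastLessThan_iff)
  have I: "finite I" "card I = nat (int N - 2 * R) ^ CARD('m)"
    unfolding I_def by (simp_all add: finite_vec_box card_vec_box del: atLeastLessThan_iff)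
  have "I \<subseteq> F"
  proof
    fix k assume "k \<in> I"
    then have k: "R \<le> k $ i" "k $ i < int N - R" for i
      by (auto simp: I_def)
    have "0 \<le> k $ i \<and> k $ i < int N" for i
      using k[of i] R0 by linarith
    then show "k \<in> F" by (simp add: F_def)
  qed
  define T where "T m = cmod (\<Sum>k\<in>F. e k m * \<psi> (k + k - m))" for m
  have T_le: "T m \<le> (\<Sum>k\<in>F. a (k + k - m))" for m
    unfolding T_def by (intro sum_norm_le term_le)
  have T_C: "T m \<le> C" for m
    using norm_inf[of F m UNIV] F by (simp add: T_def C_def)
  \<comment> \<open>By antisymmetry the full sum vanishes, so \<open>T m\<close> is the modulus of
    the sum over the complement of \<open>F\<close>. A point \<open>l\<close> outside
    \<open>F\<close> differs from \<open>k\<close> by more than \<open>R\<close> in some coordinate;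
    doubling makes this more than 2R, which pushes 2l - m out of \<open>X\<close>.\<close>
  have T_far: "T m \<le> \<epsilon>" if "k \<in> I" "k + k - m \<in> X" for k m
  proof -
    have "(\<Sum>\<^sub>\<infinity>k. e k m * \<psi> (k + k - m)) = 0"
    proof (rule antisymmetric_sum_eq_0[of _ m])
      fix k show "e (m - k) m * \<psi> (m - k + (m - k) - m) = - (e k m * \<psi> (k + k - m))"
      proof -
        have "m - k + (m - k) - m = - (k + k - m)"
          by (simp add: vec_eq_iff)
        then show ?thesis
          by (simp only: e_sym odd mult_minus_right)
      qed
    qed
    moreover have "(\<Sum>\<^sub>\<infinity>k. e k m * \<psi> (k + k - m))
        = (\<Sum>k\<in>F. e k m * \<psi> (k + k - m)) + (\<Sum>\<^sub>\<infinity>k\<in>-F. e k m * \<psi> (k + k - m))"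
      using infsum_Un_disjoint[of "\<lambda>k. e k m * \<psi> (k + k - m)" F "-F"] F(1)
        Infinite_Sum.abs_summable_summable[OF term_abs[of m]] by (simp add: Compl_partition)
    ultimately have "T m = cmod (\<Sum>\<^sub>\<infinity>k\<in>-F. e k m * \<psi> (k + k - m))"
      unfolding T_def by (simp add: add_eq_0_iff2)
    also have "\<dots> \<le> infsum a (- X)"
    proof (rule norm_inf)
      fix l assume "l \<in> - F"
      then have "\<not> (\<forall>i. l $ i \<in> {0..<int N})"
        by (simp add: F_def)
      then obtain i where i: "l $ i < 0 \<or> l $ i \<ge> int N"
        by (meson atLeastLessThan_iff not_le)
      have "R \<le> k $ i" "k $ i < int N - R" "\<bar>k $ i + k $ i - m $ i\<bar> \<le> R"
        using that by (auto simp: I_def X_def)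
      with i have "\<not> \<bar>l $ i + l $ i - m $ i\<bar> \<le> R" by linarith
      then show "l + l - m \<in> - X" by (auto simp: X_def)
    qed
    finally show ?thesis using X by simp
  qed
  have T0: "T m \<ge> 0" for m by (simp add: T_def)
  have ra_sum: "(\<lambda>m. a (k + k - m)) summable_on UNIV" for k
    using asum[of UNIV] by (simp add: summable_on_reflect_iff)
  have Ta_sum: "(\<lambda>m. T m * a (k + k - m)) summable_on UNIV" for k
    by (rule summable_on_comparison_test[OF summable_on_cmult_right[OF ra_sum, of C k]])
       (auto intro!: mult_right_mono T_C a0 mult_nonneg_nonneg T0)
  have U_C: "(\<Sum>\<^sub>\<infinity>m. T m * a (k + k - m)) \<le> C\<^sup>2" for k
  proof -
    have "(\<Sum>\<^sub>\<infinity>m. T m * a (k + k - m)) \<le> (\<Sum>\<^sub>\<infinity>m. C * a (k + k - m))"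
      by (intro infsum_mono Ta_sum summable_on_cmult_right ra_sum mult_right_mono T_C a0)
    also have "\<dots> = C\<^sup>2"
      by (simp add: infsum_cmult_right' infsum_reflect C_def power2_eq_square)
    finally show ?thesis .
  qed
  \<comment> \<open>Where 2k - m lies in \<open>X\<close>, \<open>T_far\<close> bounds
    \<open>T m\<close>; elsewhere \<open>T m\<close> is at most \<open>C\<close> and
    \<open>b\<close>, the part of \<open>a\<close> outside \<open>X\<close>, has small sum.\<close>
  have U_far: "(\<Sum>\<^sub>\<infinity>m. T m * a (k + k - m)) \<le> 2 * \<epsilon> * C" if "k \<in> I" for k
  proof -
    define b where "b m = (if m \<in> X then 0 else a m)" for m
    have b_sum: "b summable_on UNIV"
      by (rule summable_on_comparison_test[OF asum]) (auto simp: b_def a0)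
    have b_inf: "infsum b UNIV = infsum a (- X)"
      by (rule infsum_cong_neutral) (auto simp: b_def)
    have rb_sum: "(\<lambda>m. b (k + k - m)) summable_on UNIV"
      using b_sum by (simp add: summable_on_reflect_iff)
    have le: "T m * a (k + k - m) \<le> \<epsilon> * a (k + k - m) + C * b (k + k - m)" for m
    proof (cases "k + k - m \<in> X")
      case True
      then show ?thesis using T_far[OF that True] by (simp add: b_def mult_right_mono a0)
    next
      case False
      have "T m * a (k + k - m) \<le> C * a (k + k - m)" by (intro mult_right_mono T_C a0)
      moreover have "0 \<le> \<epsilon> * a (k + k - m)" using \<epsilon>(1) a0 by simp
      ultimately show ?thesis using False by (simp add: b_def)
    qed
    have "(\<Sum>\<^sub>\<infinity>m. T m * a (k + k - m)) \<le> (\<Sum>\<^sub>\<infinity>m. \<epsilon> * a (k + k - m) + C * b (k + k - m))"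
      by (intro infsum_mono Ta_sum summable_on_add summable_on_cmult_right ra_sum rb_sum le)
    also have "\<dots> = (\<Sum>\<^sub>\<infinity>m. \<epsilon> * a (k + k - m)) + (\<Sum>\<^sub>\<infinity>m. C * b (k + k - m))"
      by (intro infsum_add summable_on_cmult_right ra_sum rb_sum)
    also have "\<dots> = \<epsilon> * C + C * infsum a (- X)"
      by (simp add: infsum_cmult_right' infsum_reflect C_def b_inf)
    also have "\<dots> \<le> 2 * \<epsilon> * C" using mult_left_mono[OF X C0] by (simp add: mult_ac)
    finally show ?thesis .
  qed
  have Ta_hs: "((\<lambda>m. \<Sum>k\<in>F. T m * a (k + k - m)) has_sum (\<Sum>k\<in>F. \<Sum>\<^sub>\<infinity>m. T m * a (k + k - m))) UNIV"
    by (intro has_sum_finite_sum has_sum_infsum Ta_sum)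
  \<comment> \<open>One factor of the square is expanded by \<open>T_le\<close>, and the sums are
    exchanged so that the cost is charged to the points of \<open>F\<close> one by one.\<close>
  have "(\<Sum>\<^sub>\<infinity>m. (T m)\<^sup>2) \<le> (\<Sum>\<^sub>\<infinity>m. \<Sum>k\<in>F. T m * a (k + k - m))"
  proof (rule infsum_mono)
    show *: "(\<lambda>m. \<Sum>k\<in>F. T m * a (k + k - m)) summable_on UNIV"
      using Ta_hs by (rule has_sum_imp_summable)
    show le: "(T m)\<^sup>2 \<le> (\<Sum>k\<in>F. T m * a (k + k - m))" for m
      using mult_left_mono[OF T_le T0, of m m] by (simp add: power2_eq_square sum_distrib_left)
    show "(\<lambda>m. (T m)\<^sup>2) summable_on UNIV"
      by (rule summable_on_comparison_test[OF *]) (use le in auto)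
  qed
  also have "\<dots> = (\<Sum>k\<in>F. \<Sum>\<^sub>\<infinity>m. T m * a (k + k - m))"
    using Ta_hs by (rule infsumI)
  also have "\<dots> = (\<Sum>k\<in>I. \<Sum>\<^sub>\<infinity>m. T m * a (k + k - m)) + (\<Sum>k\<in>F - I. \<Sum>\<^sub>\<infinity>m. T m * a (k + k - m))"
    using sum.subset_diff[OF \<open>I \<subseteq> F\<close> F(1)] by (simp add: add.commute)
  also have "\<dots> \<le> (\<Sum>k\<in>I. 2 * \<epsilon> * C) + (\<Sum>k\<in>F - I. C\<^sup>2)"
    by (intro add_mono sum_mono U_far U_C)
  also have "\<dots> = card I * (2 * \<epsilon> * C) + (real (card F) - card I) * C\<^sup>2"
    using card_Diff_subset[OF I(1) \<open>I \<subseteq> F\<close>] card_mono[OF F(1) \<open>I \<subseteq> F\<close>] by (simp add: of_nat_diff)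
  also have "\<dots> \<le> card F * (\<delta> / 2) + card F * (\<delta> / 2)"
  proof (rule add_mono)
    show "card I * (2 * \<epsilon> * C) \<le> card F * (\<delta> / 2)"
      using \<epsilon> C0 \<open>\<delta> > 0\<close> card_mono[OF F(1) \<open>I \<subseteq> F\<close>] by (intro mult_mono) auto
    have "real (nat (int N - 2 * R)) = real N * (1 - 2 * of_int R / real N)"
      using NR by (simp add: right_diff_distrib)
    then have "real (card I) = card F * (1 - 2 * of_int R / real N) ^ CARD('m)"
      by (simp only: I(2) F(2) of_nat_power power_mult_distrib)
    then have "(real (card F) - card I) * C\<^sup>2 = card F * (C\<^sup>2 * (1 - (1 - 2 * of_int R / real N) ^ CARD('m)))"
      by (simp add: algebra_simps)
    also have "\<dots> \<le> card F * (\<delta> / 2)"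
      using N(1) by (intro mult_left_mono) auto
    finally show "(real (card F) - card I) * C\<^sup>2 \<le> card F * (\<delta> / 2)" .
  qed
  finally have "(\<Sum>\<^sub>\<infinity>m. (T m)\<^sup>2) \<le> \<delta> * card F" by (simp add: mult.commute)
  moreover have "F \<noteq> {}" using F(2) NR by auto
  ultimately show ?thesis using F(1) that unfolding T_def by blast
qed

subsection \<open>Lattice sums\<close>

text \<open>Comparison with a two-sided geometric series centred at the floor of \<open>u\<close>,
  which makes the bound uniform in \<open>u\<close>.\<close>

lemma gaussian_sum_int_bounded:
  fixes c :: real
  assumes "c > 0"
  obtains K where "\<And>u B. finite B \<Longrightarrow> (\<Sum>j\<in>B. exp (- c * (u - of_int j)\<^sup>2)) \<le> K"
proof
  fix u :: real and B :: "int set"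
  assume B: "finite B"
  define q where "q = exp (- c)"
  have q: "0 < q" "q < 1" using assms by (auto simp: q_def)
  define n where "n = \<lfloor>u\<rfloor>"
  have geo: "(\<Sum>d\<in>D. q ^ nat \<bar>d\<bar>) \<le> 1 / (1 - q)"
    if "finite D" "inj_on (\<lambda>d. nat \<bar>d\<bar>) D" for D :: "int set"
  proof -
    have "(\<Sum>d\<in>D. q ^ nat \<bar>d\<bar>) = (\<Sum>k\<in>(\<lambda>d. nat \<bar>d\<bar>) ` D. q ^ k)"
      by (simp add: sum.reindex[OF that(2)])
    also have "\<dots> \<le> (\<Sum>k. q ^ k)"
      using q that by (intro sum_le_suminf summable_geometric) auto
    also have "\<dots> = 1 / (1 - q)"
      using q by (intro suminf_geometric) auto
    finally show ?thesis .
  qed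
  have "exp (- c * (u - of_int j)\<^sup>2) \<le> exp (3 * c) * q ^ nat \<bar>n - j\<bar>" for j
  proof -
    define x where "x = \<bar>u - of_int j\<bar>"
    \<comment> \<open>Rounding \<open>u\<close> costs at most 1; with x^2 at least 2x - 1 this gives
      x^2 at least |n - j| - 3, whence the factor exp(3c).\<close>
    have "x \<ge> \<bar>of_int (n - j)\<bar> - 1"
      unfolding x_def n_def by (simp add: abs_if) linarith
    moreover have "x\<^sup>2 \<ge> 2 * x - 1"
      using zero_le_power2[of "x - 1"] by (simp add: power2_diff)
    ultimately have "x\<^sup>2 \<ge> \<bar>of_int (n - j)\<bar> - 3" by linarith
    then have "- c * x\<^sup>2 \<le> 3 * c + real (nat \<bar>n - j\<bar>) * (- c)"
      using mult_left_mono[of "\<bar>of_int (n - j)\<bar> - 3" "x\<^sup>2" c] assms by (simp add: algebra_simps)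
    then have "exp (- c * x\<^sup>2) \<le> exp (3 * c + real (nat \<bar>n - j\<bar>) * (- c))" by simp
    then show ?thesis
      unfolding x_def q_def exp_add exp_of_nat_mult power2_abs .
  qed
  then have "(\<Sum>j\<in>B. exp (- c * (u - of_int j)\<^sup>2)) \<le> (\<Sum>j\<in>B. exp (3 * c) * q ^ nat \<bar>n - j\<bar>)"
    by (intro sum_mono)
  also have "\<dots> = exp (3 * c) * (\<Sum>d\<in>(\<lambda>j. n - j) ` B. q ^ nat \<bar>d\<bar>)"
    by (subst sum.reindex) (auto simp: inj_on_def sum_distrib_left)
  \<comment> \<open>The absolute value is injective only on each half-line, hence the split at 0 and
    two geometric series.\<close>
  also have "(\<Sum>d\<in>(\<lambda>j. n - j) ` B. q ^ nat \<bar>d\<bar>)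
     = (\<Sum>d\<in>(\<lambda>j. n - j) ` B \<inter> {0..}. q ^ nat \<bar>d\<bar>) + (\<Sum>d\<in>(\<lambda>j. n - j) ` B - {0..}. q ^ nat \<bar>d\<bar>)"
    using B by (intro sum.Int_Diff) auto
  also have "\<dots> \<le> 1 / (1 - q) + 1 / (1 - q)"
    using B by (intro add_mono geo) (auto simp: inj_on_def)
  finally show "(\<Sum>j\<in>B. exp (- c * (u - of_int j)\<^sup>2)) \<le> exp (3 * c) * (1 / (1 - exp (- c)) + 1 / (1 - exp (- c)))"
    by (simp add: q_def)
qed

text \<open>Indexing by integer vectors turns lattice sums into sums over the group
  \<open>int^'m\<close>, where doubling and reflection of the index make sense.\<close>

definition lattice_point :: "real^'m^'m \<Rightarrow> int^'m \<Rightarrow> real^'m" where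
  "lattice_point M k = M *v (\<chi> i. of_int (k $ i))"

lemma lattice_point_add: "lattice_point M (k + l) = lattice_point M k + lattice_point M l"
  and lattice_point_diff: "lattice_point M (k - l) = lattice_point M k - lattice_point M l"
  and lattice_point_minus: "lattice_point M (- k) = - lattice_point M k"
proof -
  have e: "(\<chi> i. of_int ((k + l) $ i)) = (\<chi> i. of_int (k $ i)) + (\<chi> i. real_of_int (l $ i))"
    "(\<chi> i. of_int ((k - l) $ i)) = (\<chi> i. of_int (k $ i)) - (\<chi> i. real_of_int (l $ i))"
    "(\<chi> i. of_int ((- k) $ i)) = - (\<chi> i. real_of_int (k $ i))"
    by (simp_all add: vec_eq_iff)
  show "lattice_point M (k + l) = lattice_point M k + lattice_point M l"
    "lattice_point M (k - l) = lattice_point M k - lattice_point M l"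
    "lattice_point M (- k) = - lattice_point M k"
    unfolding lattice_point_def e
    by (simp_all add: matrix_vector_right_distrib matrix_vector_mult_diff_distrib
        linear_neg[OF matrix_vector_mul_linear])
qed

lemma lattice_of_eq_range: "lattice_of M = range (lattice_point M)"
  for M :: "real^'m^'m"
proof -
  have "{z :: real^'m. \<forall>i. z $ i \<in> \<int>} = range (\<lambda>k :: int^'m. \<chi> i. of_int (k $ i))"
  proof (intro equalityI subsetI)
    fix z :: "real^'m" assume "z \<in> {z. \<forall>i. z $ i \<in> \<int>}"
    then show "z \<in> range (\<lambda>k :: int^'m. \<chi> i. of_int (k $ i))"
      by (intro image_eqI[of _ _ "\<chi> i. \<lfloor>z $ i\<rfloor>"]) (auto simp: vec_eq_iff)
  qed auto
  then show ?thesis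
    by (simp add: lattice_of_def lattice_point_def[abs_def] image_image)
qed

lemma inj_lattice_point:
  assumes "invertible M"
  shows "inj (lattice_point M)"
proof (rule injI)
  fix k l assume "lattice_point M k = lattice_point M l"
  then have "(\<chi> i. real_of_int (k $ i)) = (\<chi> i. real_of_int (l $ i))"
    unfolding lattice_point_def by (rule injD[OF inj_matrix_vector_mult[OF assms]])
  then show "k = l"
    by (simp add: vec_eq_iff)
qed

text \<open>An injective linear map is bounded below, so the Gaussian is dominated by a product of
  one-dimensional ones. The bound is uniform in the centre \<open>w\<close>.\<close>

lemma gaussian_lattice_sum_bounded:
  fixes M :: "real^'m^'m"
  assumes "invertible M" "c > 0"
  obtains K where "\<And>w F. finite F \<Longrightarrow> (\<Sum>k\<in>F. exp (- c * (norm (w - lattice_point M k))\<^sup>2)) \<le> K"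
proof -
  obtain \<kappa> where \<kappa>: "\<kappa> > 0" "\<And>x. \<kappa> * norm x \<le> norm (M *v x)"
    using linear_inj_bounded_below_pos[OF matrix_vector_mul_linear inj_matrix_vector_mult[OF assms(1)]] by blast
  define c' where "c' = c * \<kappa>\<^sup>2"
  have "c' > 0" using assms \<kappa> by (simp add: c'_def)
  then obtain K where K: "\<And>u B. finite B \<Longrightarrow> (\<Sum>j\<in>B. exp (- c' * (u - of_int j)\<^sup>2)) \<le> K"
    using gaussian_sum_int_bounded by blast
  have "(\<Sum>k\<in>F. exp (- c * (norm (w - lattice_point M k))\<^sup>2)) \<le> K ^ CARD('m)" if "finite F" for w F
  proof -
    obtain u where u: "w = M *v u"
      using assms(1) by (metis invertible_def matrix_vector_mul_assoc matrix_vector_mul_lid)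
    \<comment> \<open>All coordinates occurring in \<open>F\<close>: enlarging \<open>F\<close> to
      the cube over \<open>B\<close> lets the sum of products factor into a product of sums.\<close>
    define B where "B = (\<Union>k\<in>F. range (\<lambda>i. k $ i))"
    have B: "finite B" using that by (auto simp: B_def)
    have le: "exp (- c * (norm (w - lattice_point M k))\<^sup>2) \<le> (\<Prod>i\<in>UNIV. exp (- c' * (u $ i - of_int (k $ i))\<^sup>2))" for k
    proof -
      define y where "y = u - (\<chi> i. of_int (k $ i))"
      have "w - lattice_point M k = M *v y"
        by (simp add: u lattice_point_def y_def matrix_vector_mult_diff_distrib)
      then have "(norm (w - lattice_point M k))\<^sup>2 \<ge> (\<kappa> * norm y)\<^sup>2"
        using \<kappa> by (simp add: power_mono)
      moreover have "(norm y)\<^sup>2 = (\<Sum>i\<in>UNIV. (u $ i - of_int (k $ i))\<^sup>2)"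
        by (simp add: y_def norm_vec_def L2_set_def sum_nonneg)
      ultimately have "- c * (norm (w - lattice_point M k))\<^sup>2 \<le> (\<Sum>i\<in>UNIV. - c' * (u $ i - of_int (k $ i))\<^sup>2)"
        using assms(2) by (simp add: c'_def power_mult_distrib sum_negf flip: sum_distrib_left)
      then show ?thesis by (simp flip: exp_sum)
    qed
    have "(\<Sum>k\<in>F. exp (- c * (norm (w - lattice_point M k))\<^sup>2))
        \<le> (\<Sum>k\<in>F. \<Prod>i\<in>UNIV. exp (- c' * (u $ i - of_int (k $ i))\<^sup>2))"
      by (intro sum_mono le)
    also have "\<dots> \<le> (\<Sum>k\<in>{k. \<forall>i. k $ i \<in> B}. \<Prod>i\<in>UNIV. exp (- c' * (u $ i - of_int (k $ i))\<^sup>2))"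
      by (intro sum_mono2 finite_vec_box B) (auto simp: B_def intro: prod_nonneg)
    also have "\<dots> = (\<Sum>p\<in>UNIV \<rightarrow>\<^sub>E B. \<Prod>i\<in>UNIV. exp (- c' * (u $ i - of_int (p i))\<^sup>2))"
      unfolding vec_box_eq_image
      by (subst sum.reindex) (auto simp: inj_on_def vec_lambda_inject)
    also have "\<dots> = (\<Prod>i\<in>UNIV. \<Sum>j\<in>B. exp (- c' * (u $ i - of_int j)\<^sup>2))"
      using B by (intro prod_sum_PiE[symmetric]) auto
    also have "\<dots> \<le> (\<Prod>i\<in>(UNIV :: 'm set). K)"
      by (intro prod_mono conjI K B sum_nonneg) auto
    finally show ?thesis by simp
  qed
  then show ?thesis by (rule that)
qed

text \<open>One nonzero coefficient, at \<open>b\<close>, serves as reference. Times its modulus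
  \<open>v\<close>, each coefficient is at most an integral of the modulus of
  \<open>stft g g\<close> against a Gaussian; these Gaussians have bounded sum, and dividing by
  \<open>v\<close> gives the claim.\<close>

lemma summable_coherent_lattice:
  fixes M :: "real^('n::finite + 'n)^('n + 'n)"
  assumes g: "g \<in> S0" and M: "invertible M"
  shows "(\<lambda>k. cmod (L2_inner g (coherent (lattice_point M k)))) summable_on UNIV"
proof (cases "\<forall>k. L2_inner g (coherent (lattice_point M k)) = 0")
  case True
  then show ?thesis by simp
next
  case False
  have gL2: "g \<in> L2" and Vint: "integrable lborel (stft g g)"
    using g by (auto simp: S0_def)
  obtain l where "L2_inner g (coherent (lattice_point M l)) \<noteq> 0" using False by blast
  define b where "b = lattice_point M l"
  define v where "v = cmod (L2_inner g (coherent b))"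
  have v: "v > 0" using \<open>L2_inner g (coherent (lattice_point M l)) \<noteq> 0\<close> by (simp add: v_def b_def)
  obtain K where K: "\<And>w F. finite F \<Longrightarrow> (\<Sum>k\<in>F. exp (- (pi / 2) * (norm (w - lattice_point M k))\<^sup>2)) \<le> K"
    using gaussian_lattice_sum_bounded[OF M, of "pi / 2"] by auto
  \<comment> \<open>A majorant of the kernel: its normalising factor is at most 1, and its centre is
    arranged so that the lattice bound applies with w = z + b.\<close>
  define W where "W k z = exp (- (pi / 2) * (norm (z + b - lattice_point M k))\<^sup>2)" for k z
  have W_meas [measurable]: "W k \<in> borel_measurable borel" for k
    unfolding W_def[abs_def] by measurable
  have W_int: "integrable lborel (\<lambda>z. W k z * cmod (stft g g z))" for k
  proof (rule Bochner_Integration.integrable_bound[OF integrable_norm[OF Vint]])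
    show "AE z in lborel. norm (W k z * cmod (stft g g z)) \<le> norm (cmod (stft g g z))"
      by (intro AE_I2) (simp add: W_def abs_mult mult_left_le_one_le)
    show "(\<lambda>z. W k z * cmod (stft g g z)) \<in> borel_measurable lborel"
      using Vint by measurable
  qed
  have le: "cmod (L2_inner g (coherent (lattice_point M k))) * v \<le> (LINT z|lborel. W k z * cmod (stft g g z))" for k
  proof -
    have "cmod (L2_inner g (coherent (lattice_point M k))) * v
        = cmod (LINT z|lborel. ambig_kernel (lattice_point M k) b z * stft g g z)"
      unfolding v_def L2_inner_coherent_product[OF gL2, symmetric] by (simp add: norm_mult)
    also have "\<dots> \<le> (LINT z|lborel. W k z * cmod (stft g g z))"
    proof (rule order_trans[OF integral_norm_bound integral_mono])
      have n: "cmod (ambig_kernel (lattice_point M k) b z) \<le> W k z" for z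
      proof -
        have "1 \<le> sqrt 2 ^ CARD('n)" by simp
        moreover have "z - (lattice_point M k - b) = z + b - lattice_point M k" by simp
        ultimately show ?thesis unfolding norm_ambig_kernel W_def
          by (simp only:) (simp add: divide_le_eq mult_le_cancel_left1)
      qed
      then show "cmod (ambig_kernel (lattice_point M k) b z * stft g g z) \<le> W k z * cmod (stft g g z)" for z
        by (simp add: norm_mult mult_right_mono)
      show "integrable lborel (\<lambda>z. cmod (ambig_kernel (lattice_point M k) b z * stft g g z))"
      proof (rule integrable_norm, rule Bochner_Integration.integrable_bound[OF W_int[of k]])
        show "(\<lambda>z. ambig_kernel (lattice_point M k) b z * stft g g z) \<in> borel_measurable lborel"
          using Vint by measurable
        show "AE z in lborel. norm (ambig_kernel (lattice_point M k) b z * stft g g z) \<le> norm (W k z * cmod (stft g g z))"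
          using n by (intro AE_I2) (simp add: norm_mult mult_right_mono W_def)
      qed
    qed (rule W_int)
    finally show ?thesis .
  qed
  have bound: "(\<Sum>k\<in>F. cmod (L2_inner g (coherent (lattice_point M k)))) \<le> (LINT z|lborel. K * cmod (stft g g z)) / v"
    if "finite F" for F
  proof -
    have "(\<Sum>k\<in>F. cmod (L2_inner g (coherent (lattice_point M k)))) * v
        \<le> (\<Sum>k\<in>F. LINT z|lborel. W k z * cmod (stft g g z))"
      unfolding sum_distrib_right by (intro sum_mono le)
    also have "\<dots> = (LINT z|lborel. (\<Sum>k\<in>F. W k z) * cmod (stft g g z))"
      unfolding sum_distrib_right by (intro Bochner_Integration.integral_sum[symmetric] W_int)
    also have "\<dots> \<le> (LINT z|lborel. K * cmod (stft g g z))"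
    proof (rule integral_mono)
      show "integrable lborel (\<lambda>z. (\<Sum>k\<in>F. W k z) * cmod (stft g g z))"
        unfolding sum_distrib_right by (intro Bochner_Integration.integrable_sum W_int)
      show "integrable lborel (\<lambda>z. K * cmod (stft g g z))"
        by (intro integrable_mult_right integrable_norm Vint)
      show "(\<Sum>k\<in>F. W k z) * cmod (stft g g z) \<le> K * cmod (stft g g z)" for z
        unfolding W_def by (intro mult_right_mono K that) simp
    qed
    finally show ?thesis using v by (simp add: field_simps)
  qed
  show ?thesis
    by (rule nonneg_bdd_above_summable_on) (auto intro!: bdd_aboveI2 bound)
qed

section \<open>Symplectic matrices: invariance of the form and the determinant\<close>

lemma pos_J_mat: "pos (J_mat *v x) = freq x" and freq_J_mat: "freq (J_mat *v x) = - pos x"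
  by (simp_all add: vec_eq_iff pos_def freq_def J_mat_def matrix_vector_mult_def sum_UNIV_Plus
      if_distrib[of "\<lambda>c. c * _"] cong: if_cong)

lemma symplectic_form_eq_J_mat: "symplectic_form a b = - (a \<bullet> (J_mat *v b))"
  by (simp add: inner_phase_space[of a] pos_J_mat freq_J_mat symplectic_form_def)

lemma symplectic_form_symplectic:
  assumes "symplectic S"
  shows "symplectic_form (S *v a) (S *v b) = symplectic_form a b"
proof -
  have "a v* transpose S = S *v a"
    using transpose_matrix_vector[of "transpose S" a] by simp
  then have "(S *v a) \<bullet> (J_mat *v (S *v b)) = a \<bullet> ((transpose S ** J_mat ** S) *v b)"
    by (metis dot_lmul_matrix matrix_vector_mul_assoc)
  then show ?thesis
    using assms by (simp add: symplectic_form_eq_J_mat symplectic_def)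
qed

text \<open>Taking determinants in the defining identity and cancelling the nonzero determinant of
  \<open>J_mat\<close> leaves (det S)^2 = 1.\<close>

lemma det_symplectic:
  fixes S :: "real^('n::finite + 'n)^('n + 'n)"
  assumes "symplectic S"
  shows "\<bar>det S\<bar> = 1"
proof -
  have "det (J_mat :: real^('n + 'n)^('n + 'n)) \<noteq> 0"
  proof -
    have "inj ((*v) (J_mat :: real^('n + 'n)^('n + 'n)))"
    proof (rule injI)
      fix x y :: "real^('n + 'n)" assume "J_mat *v x = J_mat *v y"
      then have "pos x = pos y" "freq x = freq y"
        using pos_J_mat[of x] pos_J_mat[of y] freq_J_mat[of x] freq_J_mat[of y] by auto
      then show "x = y"
        by (simp add: vec_eq_iff split_sum_all pos_def freq_def)
    qed
    then have "invertible (J_mat :: real^('n + 'n)^('n + 'n))"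
      by (simp add: invertible_left_inverse matrix_left_invertible_injective)
    then show ?thesis by (simp add: invertible_det_nz)
  qed
  moreover have "det S * det (J_mat :: real^('n + 'n)^('n + 'n)) * det S = det (J_mat :: real^('n + 'n)^('n + 'n))"
    using arg_cong[OF assms[unfolded symplectic_def], of det] by (simp only: det_mul det_transpose)
  ultimately have "det S * det S = 1" by simp
  then show ?thesis using abs_square_eq_1[of "det S"] by (simp add: power2_eq_square)
qed

subsection \<open>Failure of the lower frame bound\<close>

lemma L2_norm_sum:
  assumes "\<And>k. k \<in> F \<Longrightarrow> f k \<in> L2"
  shows "of_real ((L2_norm (\<lambda>t. \<Sum>k\<in>F. f k t))\<^sup>2) = (\<Sum>k\<in>F. \<Sum>l\<in>F. L2_inner (f l) (f k))"
proof -
  define s where "s = (\<lambda>t. \<Sum>k\<in>F. f k t)"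
  have s: "s \<in> L2" unfolding s_def by (rule L2_sum[OF assms])
  have "of_real ((L2_norm s)\<^sup>2) = L2_inner s s" by (rule L2_inner_self[symmetric])
  also have "\<dots> = (\<Sum>k\<in>F. L2_inner (f k) s)"
    by (subst (1) s_def) (rule L2_inner_sum_left[OF assms s])
  also have "\<dots> = (\<Sum>k\<in>F. cnj (L2_inner s (f k)))"
    by (simp only: L2_inner_cnj)
  also have "\<dots> = (\<Sum>k\<in>F. cnj (\<Sum>l\<in>F. L2_inner (f l) (f k)))"
    unfolding s_def by (intro sum.cong refl arg_cong[of _ _ cnj] L2_inner_sum_left assms)
  also have "\<dots> = (\<Sum>k\<in>F. \<Sum>l\<in>F. L2_inner (f k) (f l))"
    by (simp add: L2_inner_cnj)
  also have "\<dots> = (\<Sum>k\<in>F. \<Sum>l\<in>F. L2_inner (f l) (f k))"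
    by (rule sum.swap)
  finally show ?thesis by (simp only: s_def)
qed

lemma exp_two_pi_Ints:
  assumes "s \<in> \<int>"
  shows "exp (2 * pi * \<i> * of_real s) = 1"
proof -
  from assms obtain n where "s = of_int n" by (rule Ints_cases)
  then show ?thesis
    using exp_2pi_1_int[of n] by (simp add: mult_ac)
qed

text \<open>Half-integrality of the form enters twice: it makes the phases \<open>e\<close>
  symmetric under k \<mapsto> m - k, and it makes the inner products of coherent states on the
  doubled lattice positive.\<close>

lemma not_gabor_frame_if_half_integral_form:
  fixes g :: "real^'n \<Rightarrow> complex" and M :: "real^('n + 'n)^('n + 'n)"
  assumes g: "g \<in> S0" and odd: "\<And>t. g t = - g (- t)" and M: "invertible M"
    and half: "\<And>k l. 2 * symplectic_form (lattice_point M k) (lattice_point M l) \<in> \<int>"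
  shows "\<not> gabor_frame g (lattice_of M)"
proof
  assume "gabor_frame g (lattice_of M)"
  then obtain A where A: "A > 0"
    "\<And>f. f \<in> L2 \<Longrightarrow> A * (L2_norm f)\<^sup>2 \<le> (\<Sum>\<^sub>\<infinity>l\<in>lattice_of M. (cmod (L2_inner f (tf_shift l g)))\<^sup>2)"
    unfolding gabor_frame_def is_frame_def by blast
  define P where "P = lattice_point M"
  define D where "D = sqrt 2 ^ CARD('n)"
  have D: "D > 0" by (simp add: D_def)
  have gL2: "g \<in> L2" using g by (simp add: S0_def)
  define \<psi> where "\<psi> m = L2_inner (coherent (P m)) g" for m
  \<comment> \<open>The part of the covariance phase that depends on \<open>k\<close>, at the
    doubled point \<open>P (k + k)\<close>.\<close>
  define e where "e k m = exp (2 * pi * \<i> * of_real (symplectic_form (P (k + k)) (P m) / 2))" for k m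
  have P_add: "P (k + l) = P k + P l" and P_diff: "P (k - l) = P k - P l" and P_minus: "P (- k) = - P k" for k l
    by (simp_all add: P_def lattice_point_add lattice_point_diff lattice_point_minus)
  have form_double: "symplectic_form (P (k + k)) b = 2 * symplectic_form (P k) b" for k b
    unfolding P_add symplectic_form_def pos_add freq_add inner_add_left by simp
  have "(\<lambda>m. cmod (L2_inner g (coherent (P m)))) summable_on UNIV"
    unfolding P_def by (rule summable_coherent_lattice[OF g M])
  then have "(\<lambda>m. cmod (\<psi> m)) summable_on UNIV"
    unfolding \<psi>_def by (subst L2_inner_cnj[symmetric], subst complex_mod_cnj)
  moreover have "\<psi> (- m) = - \<psi> m" for m
    unfolding \<psi>_def P_minus by (rule L2_inner_coherent_odd[OF gL2 odd])
  moreover have "cmod (e k m) \<le> 1" for k m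
    by (simp add: e_def)
  \<comment> \<open>The form vanishes on the pair \<open>P m\<close>, \<open>P m\<close>, so the
    substitution only changes \<open>s\<close> to -s; the two phases agree because 2s is an
    integer.\<close>
  moreover have "e (m - k) m = e k m" for k m
  proof -
    define s where "s = symplectic_form (P k) (P m)"
    have "symplectic_form (P (m - k)) (P m) = - s"
      by (simp add: P_diff symplectic_form_def pos_diff freq_diff inner_diff_left inner_diff_right inner_commute s_def)
    then have 1: "e (m - k) m = exp (2 * pi * \<i> * of_real (- s))"
      unfolding e_def form_double by simp
    have 2: "e k m = exp (2 * pi * \<i> * of_real s)"
      unfolding e_def form_double s_def by simp
    have "2 * s \<in> \<int>" unfolding s_def P_def by (rule half)
    then have "exp (2 * pi * \<i> * of_real (2 * s)) = 1"
      by (rule exp_two_pi_Ints)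
    moreover have "e k m = e (m - k) m * exp (2 * pi * \<i> * of_real (2 * s))"
      unfolding 1 2 by (simp add: mult_exp_exp algebra_simps)
    ultimately show ?thesis by simp
  qed
  \<comment> \<open>The squared norm of \<open>f\<close> will be at least \<open>card F / D\<close>,
    so this choice of \<open>\<delta>\<close> is half of what the lower frame bound demands.\<close>
  moreover have "A / (2 * D) > 0" using A D by simp
  ultimately obtain F where F: "finite F" "F \<noteq> {}"
    "(\<Sum>\<^sub>\<infinity>m. (cmod (\<Sum>k\<in>F. e k m * \<psi> (k + k - m)))\<^sup>2) \<le> A / (2 * D) * card F"
    by (rule odd_sequence_box_estimate)
  define f where "f = (\<lambda>t. \<Sum>k\<in>F. coherent (P (k + k)) t)"
  have fL2: "f \<in> L2"
    unfolding f_def by (intro L2_sum coherent_L2)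
  \<comment> \<open>The remaining phase \<open>c\<close> depends on \<open>m\<close> only, so it
    leaves the sum over \<open>k\<close> and disappears in the modulus.\<close>
  have coeff: "cmod (L2_inner f (tf_shift (P m) g)) = cmod (\<Sum>k\<in>F. e k m * \<psi> (k + k - m))" for m
  proof -
    define c where "c = exp (2 * pi * \<i> * of_real (- (pos (P m) \<bullet> freq (P m)) / 2))"
    have "L2_inner (coherent (P (k + k))) (tf_shift (P m) g) = c * (e k m * \<psi> (k + k - m))" for k
      unfolding L2_inner_coherent_tf_shift[OF gL2] c_def e_def \<psi>_def P_diff mult.assoc[symmetric] mult_exp_exp
      by (simp add: diff_divide_distrib algebra_simps)
    then have "L2_inner f (tf_shift (P m) g) = c * (\<Sum>k\<in>F. e k m * \<psi> (k + k - m))"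
      unfolding f_def
      by (subst L2_inner_sum_left) (auto simp: sum_distrib_left coherent_L2 tf_shift_L2 gL2)
    then show ?thesis by (simp add: norm_mult c_def)
  qed
  have "A * (L2_norm f)\<^sup>2 \<le> (\<Sum>\<^sub>\<infinity>l\<in>range P. (cmod (L2_inner f (tf_shift l g)))\<^sup>2)"
    using A(2)[OF fL2] by (simp add: lattice_of_eq_range P_def)
  also have "\<dots> = (\<Sum>\<^sub>\<infinity>m. (cmod (\<Sum>k\<in>F. e k m * \<psi> (k + k - m)))\<^sup>2)"
    using inj_lattice_point[OF M] by (simp add: infsum_reindex P_def[symmetric] o_def coeff)
  also have "\<dots> \<le> A / (2 * D) * card F" by (rule F(3))
  finally have upper: "A * (L2_norm f)\<^sup>2 \<le> A / (2 * D) * card F" .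
  define r where "r k l = exp (- pi / 2 * (norm (P (l + l) - P (k + k)))\<^sup>2) / D" for k l
  have inner: "L2_inner (coherent (P (l + l))) (coherent (P (k + k))) = of_real (r k l)" for k l
  proof -
    \<comment> \<open>Doubling both points multiplies the form by 4, so half of it is an integer and
      the phase is 1.\<close>
    have "symplectic_form (P (l + l)) (P (k + k)) / 2 = 2 * symplectic_form (P l) (P k)"
      unfolding form_double unfolding P_add symplectic_form_def pos_add freq_add inner_add_right by simp
    moreover have "2 * symplectic_form (P l) (P k) \<in> \<int>" unfolding P_def by (rule half)
    ultimately have "exp (2 * pi * \<i> * of_real (symplectic_form (P (l + l)) (P (k + k)) / 2)) = 1"
      by (simp only: exp_two_pi_Ints)
    then show ?thesis
      unfolding L2_inner_coherent exp_add r_def D_def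
      by (simp only: mult_1_right exp_of_real of_real_divide)
  qed
  have "complex_of_real ((L2_norm f)\<^sup>2) = of_real (\<Sum>k\<in>F. \<Sum>l\<in>F. r k l)"
    unfolding f_def by (subst L2_norm_sum) (simp_all only: coherent_L2 inner of_real_sum)
  then have norm_f: "(L2_norm f)\<^sup>2 = (\<Sum>k\<in>F. \<Sum>l\<in>F. r k l)"
    by (simp only: of_real_eq_iff)
  \<comment> \<open>All entries are positive, so only the diagonal is kept.\<close>
  have "r k k \<le> (\<Sum>l\<in>F. r k l)" if "k \<in> F" for k
    by (rule member_le_sum[OF that _ F(1)]) (use D in \<open>simp add: r_def\<close>)
  then have "(\<Sum>k\<in>F. r k k) \<le> (L2_norm f)\<^sup>2"
    unfolding norm_f by (rule sum_mono)
  moreover have "r k k = 1 / D" for k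
    by (simp add: r_def)
  ultimately have "card F / D \<le> (L2_norm f)\<^sup>2"
    by simp
  then have "A * (card F / D) \<le> A * (L2_norm f)\<^sup>2"
    using A(1) by (intro mult_left_mono) auto
  also note upper
  finally have "A * (card F / D) \<le> A / (2 * D) * card F" .
  moreover have "card F > 0" using F by (simp add: card_gt_0_iff)
  ultimately show False
    using A(1) D by (simp add: field_simps)
qed

section \<open>Symplectic lattices of volume \<open>2 ^ -d\<close>\<close>

theorem theorem1p1:
  fixes g :: "real^'n \<Rightarrow> complex" and \<Lambda> :: "(real^('n + 'n)) set"
  assumes "g \<in> S0"
    and "\<forall>t. g t = - g (- t)"
    and "symplectic_lattice \<Lambda>"
    and "lattice_vol \<Lambda> = 1 / 2 ^ CARD('n)"
  shows "\<not> gabor_frame g \<Lambda> \<and> \<Lambda> \<notin> full_frame_set g"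
proof -
  obtain c S where c: "c > 0" and S: "symplectic S" and \<Lambda>: "\<Lambda> = lattice_of (c *\<^sub>R S)"
    using assms(3) by (auto simp: symplectic_lattice_def)
  have "c *\<^sub>R S = (\<chi> i. c *s S $ i)"
    by (simp add: vec_eq_iff)
  then have "det (c *\<^sub>R S) = c ^ CARD('n + 'n) * det S"
    using det_rows_mul[of "\<lambda>_. c" "\<lambda>i. S $ i"] by simp
  then have det: "\<bar>det (c *\<^sub>R S)\<bar> = (c\<^sup>2) ^ CARD('n)"
    using c det_symplectic[OF S] by (simp add: abs_mult power_mult[symmetric] mult_2)
  then have inv: "invertible (c *\<^sub>R S)"
    using c by (auto simp: invertible_det_nz)
  \<comment> \<open>Since \<open>S\<close> has determinant of modulus 1, the volume is a power of
    \<open>c\<close> alone and fixes the scaling.\<close>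
  have "(c\<^sup>2) ^ CARD('n) = (1 / 2) ^ CARD('n)"
    using assms(4) det lattice_vol_lattice_of[OF inv] by (simp add: \<Lambda> power_one_over)
  then have c2: "c\<^sup>2 = 1 / 2"
    by (rule power_eq_imp_eq_base) auto
  \<comment> \<open>Scaling multiplies the form by c^2 = 1/2 and \<open>S\<close> preserves it, so
    twice the value is the form of two integer vectors.\<close>
  have "2 * symplectic_form (lattice_point (c *\<^sub>R S) k) (lattice_point (c *\<^sub>R S) l) \<in> \<int>" for k l
  proof -
    define x y :: "real^('n + 'n)" where "x = (\<chi> i. of_int (k $ i))" and "y = (\<chi> i. of_int (l $ i))"
    have "pos (c *\<^sub>R z) = c *\<^sub>R pos z" "freq (c *\<^sub>R z) = c *\<^sub>R freq z" for z :: "real^('n + 'n)"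
      by (simp_all add: pos_def freq_def vec_eq_iff)
    then have scale: "symplectic_form (c *\<^sub>R a) (c *\<^sub>R b) = c\<^sup>2 * symplectic_form a b" for a b :: "real^('n + 'n)"
      by (simp add: symplectic_form_def power2_eq_square algebra_simps)
    have "2 * symplectic_form (lattice_point (c *\<^sub>R S) k) (lattice_point (c *\<^sub>R S) l) = symplectic_form x y"
      unfolding lattice_point_def scaleR_matrix_vector_assoc[symmetric] x_def[symmetric] y_def[symmetric]
        scale c2 symplectic_form_symplectic[OF S] by simp
    moreover have "symplectic_form x y \<in> \<int>"
      by (auto simp: symplectic_form_def inner_vec_def pos_def freq_def x_def y_def intro!: Ints_diff Ints_sum Ints_mult)
    ultimately show ?thesis by simp
  qed
  then have "\<not> gabor_frame g \<Lambda>"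
    using not_gabor_frame_if_half_integral_form[OF assms(1) _ inv] assms(2) unfolding \<Lambda> by blast
  then show ?thesis by (simp add: full_frame_set_def)
qed

end
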